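(* Let $P_\lambda$ and $P_\mu$ be Poisson PP distributions with sigma-finite intensity measures $\lambda$ and $\mu$ on a measurable space $(S,\mathcal S)$. The following are equivalent: (i) $P_\lambda\ll P_\mu$. (ii) $\lambda\ll\mu$ and $H(\lambda,\mu)<\infty$.
   Context: Point patterns: $N(S)$ is the set of measures on $(S,\mathcal S)$ that can be written as a countable sum of integer-valued finite measures, equipped with the sigma-algebra $\mathcal N(S)$ generated by the evaluation maps $\eta\mapsto\eta(B)$, $B\in\mathcal S$. Poisson PP distribution: for a sigma-finite measure $\lambda$ on $(S,\mathcal S)$, $P_\lambda$ is the unique probability measure on $(N(S),\mathcal N(S))$ under which $\eta(B_1),\dots,\eta(B_n)$ are independent for all $n\ge1$ and mutually disjoint $B_1,\dots,B_n\in\mathcal S$, and $\eta(B)$ is Poisson distributed with mean $\lambda(B)$ for every $B\in\mathcal S$ (with $\mathrm{Poi}(0)=\delta_0$, $\mathrm{Poi}(\infty)=\delta_\infty$). Hellinger distance of sigma-finite measures: $H(\lambda,\mu)=\left(\frac12\int_S(\sqrt f-\sqrt g)^2\,d\nu\right)^{1/2}\in[0,\infty]$, where $f,g$ are densities of $\lambda,\mu$ with respect to a sigma-finite measure $\nu$ (the value does not depend on the choice). As usual, $\lambda\ll\mu$ means that $\mu(A)=0$ implies $\lambda(A)=0$. *)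

theory Defs
  imports "HOL-Probability.Probability"
begin

section \<open>Point patterns\<close>

text \<open>Measurable spaces are represented by measures \<open>S\<close> of which only the carrier
  \<open>space S\<close> and the sigma-algebra \<open>sets S\<close> matter.\<close>

definition integer_valued_measure :: "'a measure \<Rightarrow> bool" where
  "integer_valued_measure \<eta> \<longleftrightarrow> (\<forall>B\<in>sets \<eta>. \<exists>n::nat. emeasure \<eta> B = of_nat n)"

text \<open>Finite sums are covered by the sequences below, since the zero measure is finite and
  integer-valued.\<close>

definition point_patterns :: "'a measure \<Rightarrow> 'a measure set" where
  "point_patterns S = {\<eta>. sets \<eta> = sets S \<and>
     (\<exists>\<zeta> :: nat \<Rightarrow> 'a measure.
        (\<forall>i. sets (\<zeta> i) = sets S \<and> finite_measure (\<zeta> i) \<and> integer_valued_measure (\<zeta> i)) \<and>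
        (\<forall>B\<in>sets S. emeasure \<eta> B = (\<Sum>i. emeasure (\<zeta> i) B)))}"

definition point_pattern_algebra :: "'a measure \<Rightarrow> 'a measure measure" where
  "point_pattern_algebra S =
     (SUP B \<in> sets S. vimage_algebra (point_patterns S) (\<lambda>\<eta>. emeasure \<eta> B) borel)"

lemma space_point_pattern_algebra: "space (point_pattern_algebra S) = point_patterns S"
  by (auto simp: point_pattern_algebra_def space_Sup_eq_UN)

lemma measurable_emeasure_point_pattern_algebra:
  assumes "B \<in> sets S"
  shows "(\<lambda>\<eta>. emeasure \<eta> B) \<in> borel_measurable (point_pattern_algebra S)"
  unfolding point_pattern_algebra_def
  using assms by (auto intro!: measurable_Sup1 measurable_vimage_algebra1)

section \<open>Poisson point processes\<close>

text \<open>\<open>poisson_pmf\<close> is only specified for positive rates, so the degenerate means \<open>0\<close> and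
  \<open>\<infinity>\<close> are treated separately.\<close>

definition poisson_measure :: "ennreal \<Rightarrow> ennreal measure" where
  "poisson_measure m =
     (if m = 0 then return borel 0
      else if m = \<infinity> then return borel \<infinity>
      else distr (measure_pmf (poisson_pmf (enn2real m))) borel of_nat)"

text \<open>\<open>poisson_pp_distribution S lam P\<close>: the measure \<open>P\<close> on the space of point patterns is the
  Poisson PP distribution with intensity measure \<open>lam\<close>.\<close>

definition poisson_pp_distribution ::
    "'a measure \<Rightarrow> 'a measure \<Rightarrow> 'a measure measure \<Rightarrow> bool" where
  "poisson_pp_distribution S lam P \<longleftrightarrow>
     prob_space P \<and> sets P = sets (point_pattern_algebra S) \<and>
     (\<forall>n\<ge>1. \<forall>B :: nat \<Rightarrow> 'a set.
        (\<forall>i\<in>{1..n}. B i \<in> sets S) \<and> disjoint_family_on B {1..n} \<longrightarrow>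
        prob_space.indep_vars P (\<lambda>_. borel) (\<lambda>i \<eta>. emeasure \<eta> (B i)) {1..n}) \<and>
     (\<forall>B\<in>sets S. distr P borel (\<lambda>\<eta>. emeasure \<eta> B) = poisson_measure (emeasure lam B))"

section \<open>Hellinger distance of sigma-finite measures\<close>

definition ennsqrt :: "ennreal \<Rightarrow> ennreal" where
  "ennsqrt x = (if x = \<infinity> then \<infinity> else ennreal (sqrt (enn2real x)))"

definition densities_wrt ::
    "'a measure \<Rightarrow> 'a measure \<Rightarrow> 'a measure \<Rightarrow> ('a \<Rightarrow> real) \<Rightarrow> ('a \<Rightarrow> real) \<Rightarrow> bool" where
  "densities_wrt \<nu> lam mu f g \<longleftrightarrow>
     sigma_finite_measure \<nu> \<and>
     f \<in> borel_measurable \<nu> \<and> (\<forall>x. 0 \<le> f x) \<and> density \<nu> (\<lambda>x. ennreal (f x)) = lam \<and>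
     g \<in> borel_measurable \<nu> \<and> (\<forall>x. 0 \<le> g x) \<and> density \<nu> (\<lambda>x. ennreal (g x)) = mu"

definition hellinger_formula :: "'a measure \<Rightarrow> ('a \<Rightarrow> real) \<Rightarrow> ('a \<Rightarrow> real) \<Rightarrow> ennreal" where
  "hellinger_formula \<nu> f g =
     ennsqrt ((1 / 2) * (\<integral>\<^sup>+ x. ennreal ((sqrt (f x) - sqrt (g x))\<^sup>2) \<partial>\<nu>))"

text \<open>The description is proper by \<open>hellinger_dist_eq\<close> and \<open>densities_wrt_exist\<close> below.\<close>

definition hellinger_dist :: "'a measure \<Rightarrow> 'a measure \<Rightarrow> ennreal" where
  "hellinger_dist lam mu =
     (THE h. \<exists>\<nu> f g. densities_wrt \<nu> lam mu f g \<and> h = hellinger_formula \<nu> f g)"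

definition plus_measure :: "'a measure \<Rightarrow> 'a measure \<Rightarrow> 'a measure" where
  "plus_measure M N = measure_of (space M) (sets M) (\<lambda>A. emeasure M A + emeasure N A)"

lemma space_plus_measure [simp]: "space (plus_measure M N) = space M"
  and sets_plus_measure [simp]: "sets (plus_measure M N) = sets M"
  by (auto simp: plus_measure_def)

lemma emeasure_plus_measure:
  assumes "sets M = sets N" "A \<in> sets M"
  shows "emeasure (plus_measure M N) A = emeasure M A + emeasure N A"
  unfolding plus_measure_def
proof (rule emeasure_measure_of_sigma)
  show "sigma_algebra (space M) (sets M)" ..
  show "positive (sets M) (\<lambda>A. emeasure M A + emeasure N A)"
    by (simp add: positive_def)
  show "countably_additive (sets M) (\<lambda>A. emeasure M A + emeasure N A)"
  proof (rule countably_additiveI)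
    fix A :: "nat \<Rightarrow> _" assume "range A \<subseteq> sets M" "disjoint_family A"
    then show "(\<Sum>i. emeasure M (A i) + emeasure N (A i)) =
        emeasure M (\<Union>i. A i) + emeasure N (\<Union>i. A i)"
      using assms(1) by (subst suminf_add[symmetric]) (simp_all add: suminf_emeasure)
  qed
qed fact

lemma sigma_finite_plus_measure:
  assumes "sigma_finite_measure M" "sigma_finite_measure N" "sets M = sets N"
  shows "sigma_finite_measure (plus_measure M N)"
proof -
  obtain A where A: "countable A" "A \<subseteq> sets M" "\<Union>A = space M" "\<forall>a\<in>A. emeasure M a \<noteq> \<infinity>"
    using assms(1) unfolding sigma_finite_measure_def by auto
  obtain B where B: "countable B" "B \<subseteq> sets N" "\<Union>B = space N" "\<forall>b\<in>B. emeasure N b \<noteq> \<infinity>"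
    using assms(2) unfolding sigma_finite_measure_def by auto
  have sp: "space M = space N" using assms(3) by (rule sets_eq_imp_space_eq)
  let ?C = "(\<lambda>(a, b). a \<inter> b) ` (A \<times> B)"
  have "emeasure (plus_measure M N) (a \<inter> b) \<noteq> \<infinity>" if "a \<in> A" "b \<in> B" for a b
  proof -
    have ab: "a \<in> sets M" "b \<in> sets M" using that A(2) B(2) assms(3) by auto
    have "emeasure M (a \<inter> b) \<le> emeasure M a" "emeasure N (a \<inter> b) \<le> emeasure N b"
      using ab assms(3) by (auto intro!: emeasure_mono)
    then have "emeasure M (a \<inter> b) \<noteq> \<infinity>" "emeasure N (a \<inter> b) \<noteq> \<infinity>"
      using A(4) B(4) that by (auto simp: top_unique)
    then show ?thesis
      using ab assms(3) by (simp add: emeasure_plus_measure)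
  qed
  moreover have "\<Union>?C = space M"
  proof -
    have "\<Union>?C = \<Union>A \<inter> \<Union>B" by auto
    then show ?thesis using A(3) B(3) sp by simp
  qed
  moreover have "?C \<subseteq> sets M"
    using A(2) B(2) assms(3) by auto
  moreover have "countable ?C"
    using A(1) B(1) by auto
  ultimately show ?thesis
    unfolding sigma_finite_measure_def by (intro exI[of _ ?C]) auto
qed

lemma obtain_real_density:
  assumes "sigma_finite_measure \<nu>" "sigma_finite_measure lam" "sets lam = sets \<nu>"
    "absolutely_continuous \<nu> lam"
  obtains f :: "'a \<Rightarrow> real" where "f \<in> borel_measurable \<nu>" "\<And>x. 0 \<le> f x"
    "density \<nu> (\<lambda>x. ennreal (f x)) = lam"
proof -
  interpret sigma_finite_measure \<nu> by fact
  let ?f = "\<lambda>x. enn2real (RN_deriv \<nu> lam x)"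
  have "AE x in \<nu>. RN_deriv \<nu> lam x \<noteq> \<infinity>"
    using assms by (intro RN_deriv_finite) auto
  then have "AE x in \<nu>. ennreal (?f x) = RN_deriv \<nu> lam x"
    by eventually_elim (simp add: less_top)
  then have "density \<nu> (\<lambda>x. ennreal (?f x)) = density \<nu> (RN_deriv \<nu> lam)"
    by (intro density_cong) auto
  also have "\<dots> = lam"
    using assms by (intro density_RN_deriv) auto
  finally show ?thesis
    by (intro that[of ?f]) auto
qed

lemma absolutely_continuous_plus_measure:
  assumes "sets M = sets N"
  shows "absolutely_continuous (plus_measure M N) M" "absolutely_continuous (plus_measure M N) N"
  using assms by (auto simp: absolutely_continuous_def null_sets_def emeasure_plus_measure)

lemma densities_wrt_exist:
  assumes "sigma_finite_measure lam" "sigma_finite_measure mu" "sets lam = sets mu"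
  shows "\<exists>\<nu> f g. densities_wrt \<nu> lam mu f g"
proof -
  let ?\<nu> = "plus_measure lam mu"
  have s: "sigma_finite_measure ?\<nu>" by (rule sigma_finite_plus_measure) fact+
  obtain f where "f \<in> borel_measurable ?\<nu>" "\<And>x. 0 \<le> f x" "density ?\<nu> (\<lambda>x. ennreal (f x)) = lam"
    using obtain_real_density[OF s assms(1)] absolutely_continuous_plus_measure(1)[OF assms(3)]
    by auto
  moreover
  obtain g where "g \<in> borel_measurable ?\<nu>" "\<And>x. 0 \<le> g x" "density ?\<nu> (\<lambda>x. ennreal (g x)) = mu"
    using obtain_real_density[OF s assms(2)] absolutely_continuous_plus_measure(2)[OF assms(3)]
      assms(3) by auto
  ultimately show ?thesis
    using s unfolding densities_wrt_def by blast
qed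

lemma densities_wrt_rescale:
  assumes d: "densities_wrt \<nu> lam mu f g"
    and h: "h \<in> borel_measurable \<rho>" "\<And>x. 0 \<le> h x" "density \<rho> (\<lambda>x. ennreal (h x)) = \<nu>"
    and \<rho>: "sigma_finite_measure \<rho>"
  shows "densities_wrt \<rho> lam mu (\<lambda>x. h x * f x) (\<lambda>x. h x * g x)"
    and "hellinger_formula \<rho> (\<lambda>x. h x * f x) (\<lambda>x. h x * g x) = hellinger_formula \<nu> f g"
proof -
  have [measurable_cong]: "sets \<nu> = sets \<rho>" using h(3) by auto
  have [measurable]: "h \<in> borel_measurable \<rho>" by fact
  have [measurable]: "f \<in> borel_measurable \<rho>" "g \<in> borel_measurable \<rho>"
    using d \<open>sets \<nu> = sets \<rho>\<close> by (auto simp: densities_wrt_def cong: measurable_cong_sets)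
  have nn: "\<And>x. 0 \<le> f x" "\<And>x. 0 \<le> g x" using d by (auto simp: densities_wrt_def)
  have dens: "density \<rho> (\<lambda>x. ennreal (h x * u x)) = density \<nu> (\<lambda>x. ennreal (u x))"
    if [measurable]: "u \<in> borel_measurable \<rho>" and "\<And>x. 0 \<le> u x" for u
    using h(2) that(2) by (simp add: h(3)[symmetric] density_density_eq ennreal_mult)
  show "densities_wrt \<rho> lam mu (\<lambda>x. h x * f x) (\<lambda>x. h x * g x)"
    using d \<rho> h(2) dens[of f] dens[of g] nn unfolding densities_wrt_def by auto
  have "(\<integral>\<^sup>+ x. ennreal ((sqrt (f x) - sqrt (g x))\<^sup>2) \<partial>\<nu>) =
      (\<integral>\<^sup>+ x. ennreal (h x) * ennreal ((sqrt (f x) - sqrt (g x))\<^sup>2) \<partial>\<rho>)"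
    by (subst h(3)[symmetric], subst nn_integral_density) auto
  also have "\<dots> = (\<integral>\<^sup>+ x. ennreal ((sqrt (h x * f x) - sqrt (h x * g x))\<^sup>2) \<partial>\<rho>)"
  proof (rule nn_integral_cong)
    fix x
    have "(sqrt (h x * f x) - sqrt (h x * g x))\<^sup>2 = (sqrt (h x) * (sqrt (f x) - sqrt (g x)))\<^sup>2"
      by (simp add: real_sqrt_mult right_diff_distrib)
    also have "\<dots> = h x * (sqrt (f x) - sqrt (g x))\<^sup>2"
      using h(2) by (simp add: power_mult_distrib)
    finally show "ennreal (h x) * ennreal ((sqrt (f x) - sqrt (g x))\<^sup>2) =
        ennreal ((sqrt (h x * f x) - sqrt (h x * g x))\<^sup>2)"
      using h(2) by (simp add: ennreal_mult)
  qed
  finally show "hellinger_formula \<rho> (\<lambda>x. h x * f x) (\<lambda>x. h x * g x) = hellinger_formula \<nu> f g"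
    by (simp add: hellinger_formula_def)
qed

lemma hellinger_formula_same_reference:
  assumes "densities_wrt \<rho> lam mu f g" "densities_wrt \<rho> lam mu f' g'"
  shows "hellinger_formula \<rho> f g = hellinger_formula \<rho> f' g'"
proof -
  interpret sigma_finite_measure \<rho> using assms by (auto simp: densities_wrt_def)
  have "AE x in \<rho>. ennreal (f x) = ennreal (f' x)" "AE x in \<rho>. ennreal (g x) = ennreal (g' x)"
    using assms unfolding densities_wrt_def
    by (subst density_unique_iff[symmetric]; simp)+
  then have "AE x in \<rho>. ennreal ((sqrt (f x) - sqrt (g x))\<^sup>2) = ennreal ((sqrt (f' x) - sqrt (g' x))\<^sup>2)"
    by eventually_elim (use assms in \<open>auto simp: densities_wrt_def\<close>)
  then show ?thesis
    unfolding hellinger_formula_def by (simp only: nn_integral_cong_AE)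
qed

lemma hellinger_formula_unique:
  assumes "densities_wrt \<nu> lam mu f g" "densities_wrt \<nu>' lam mu f' g'"
  shows "hellinger_formula \<nu> f g = hellinger_formula \<nu>' f' g'"
proof -
  let ?\<rho> = "plus_measure \<nu> \<nu>'"
  have s: "sigma_finite_measure \<nu>" "sigma_finite_measure \<nu>'"
    using assms by (auto simp: densities_wrt_def)
  have "sets \<nu> = sets lam" "sets \<nu>' = sets lam"
    using assms unfolding densities_wrt_def by (metis sets_density)+
  then have eq: "sets \<nu> = sets \<nu>'" by simp
  have \<rho>: "sigma_finite_measure ?\<rho>" using s eq by (rule sigma_finite_plus_measure)
  obtain h where h: "h \<in> borel_measurable ?\<rho>" "\<And>x. 0 \<le> h x" "density ?\<rho> (\<lambda>x. ennreal (h x)) = \<nu>"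
    using obtain_real_density[OF \<rho> s(1)] absolutely_continuous_plus_measure(1)[OF eq] by auto
  obtain h' where h': "h' \<in> borel_measurable ?\<rho>" "\<And>x. 0 \<le> h' x"
      "density ?\<rho> (\<lambda>x. ennreal (h' x)) = \<nu>'"
    using obtain_real_density[OF \<rho> s(2)] absolutely_continuous_plus_measure(2)[OF eq] eq by auto
  note r = densities_wrt_rescale[OF assms(1) h \<rho>] and r' = densities_wrt_rescale[OF assms(2) h' \<rho>]
  show ?thesis
    using hellinger_formula_same_reference[OF r(1) r'(1)] r(2) r'(2) by simp
qed

lemma hellinger_dist_eq:
  assumes "densities_wrt \<nu> lam mu f g"
  shows "hellinger_dist lam mu = hellinger_formula \<nu> f g"
  unfolding hellinger_dist_def
  by (rule the_equality) (use assms hellinger_formula_unique in blast)+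

end

theory Submission
  imports Defs
begin

text \<open>Let \<open>f\<close> be the density of \<open>lam\<close> with respect to \<open>mu\<close>; the Hellinger distance is finite iff
  \<open>(sqrt f - 1)\<^sup>2\<close> is \<open>mu\<close>-integrable.

  If this integral is infinite, decompose the space into countably many sets \<open>C\<^sub>i\<close> on which a
  constant \<open>c\<^sub>i\<close> separates \<open>sqrt f\<close> from \<open>1\<close>, with \<open>\<bar>sqrt f - 1\<bar> \<le> 2 * \<bar>c\<^sub>i - 1\<bar>\<close>. Chernoff bounds for
  \<open>\<Prod>i\<le>n. c\<^sub>i ^ \<eta> (C\<^sub>i)\<close> under \<open>P_mu\<close> and for its inverse under \<open>P_lam\<close> have product at most
  \<open>exp (- \<Sum>i\<le>n. mu (C\<^sub>i) * (c\<^sub>i - 1)\<^sup>2)\<close>, which tends to \<open>0\<close>, so that by Borel--Cantelli the two laws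
  are mutually singular.

  If it is finite, put \<open>D = {f > M}\<close>, a set of small \<open>lam\<close>-measure. On the event that \<open>D\<close> contains no
  points, the likelihood ratio of the counts on any finite partition has \<open>P_mu\<close>-second moment at most
  \<open>exp (\<integral>\<^bsub>- D\<^esub> (f - 1)\<^sup>2 dmu + mu D)\<close>. By Cauchy--Schwarz, \<open>P_lam (A \<inter> {\<eta> D = 0})\<^sup>2 \<le> K * P_mu A\<close>
  for all cylinder sets \<open>A\<close>, with \<open>K\<close> independent of the partition. This bound passes to
  \<open>P_mu\<close>-null sets by approximation, and then \<open>M\<close> tends to infinity.\<close>

section \<open>Poisson counts\<close>

text \<open>Infinite counts are sent to \<open>0\<close>.\<close>

definition count_of :: "ennreal \<Rightarrow> nat" where
  "count_of x = nat \<lfloor>enn2real x\<rfloor>"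

lemma count_of_of_nat [simp]: "count_of (of_nat k) = k"
  by (simp add: count_of_def flip: ennreal_of_nat_eq_real_of_nat)

lemma measurable_count_of [measurable]: "count_of \<in> measurable borel (count_space UNIV)"
  unfolding count_of_def by measurable

text \<open>One series covers every finite mean: at \<open>m = 0\<close> the convention
  \<open>0 ^ 0 = 1\<close> leaves only the term \<open>k = 0\<close>, which matches the point mass
  at \<open>0\<close>.\<close>

lemma nn_integral_poisson_measure:
  assumes m: "0 \<le> m" and g [measurable]: "g \<in> borel_measurable borel"
  shows "(\<integral>\<^sup>+ x. g x \<partial>poisson_measure (ennreal m)) =
    (\<Sum>k. ennreal (m ^ k / fact k * exp (- m)) * g (of_nat k))"
proof (cases "m = 0")
  case True
  have "(\<Sum>k. ennreal (m ^ k / fact k * exp (- m)) * g (of_nat k)) =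
      (\<Sum>k\<in>{0}. ennreal (m ^ k / fact k * exp (- m)) * g (of_nat k))"
    by (rule suminf_finite) (auto simp: True)
  then show ?thesis
    by (simp add: True poisson_measure_def nn_integral_return)
next
  case False
  then have m': "0 < m" using m by simp
  have "(\<integral>\<^sup>+ x. g x \<partial>poisson_measure (ennreal m)) = (\<integral>\<^sup>+ k. g (of_nat k) \<partial>poisson_pmf m)"
    using m' by (simp add: poisson_measure_def nn_integral_distr)
  also have "\<dots> = (\<Sum>k. ennreal (m ^ k / fact k * exp (- m)) * g (of_nat k))"
    using m' by (simp add: nn_integral_measure_pmf nn_integral_count_space_nat)
  finally show ?thesis .
qed

lemma sets_poisson_measure [measurable_cong, simp]: "sets (poisson_measure m) = sets borel"
  by (simp add: poisson_measure_def)

lemma prob_space_poisson_measure: "prob_space (poisson_measure m)"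
  by (auto simp: poisson_measure_def prob_space_return measure_pmf.prob_space_distr)

text \<open>The probability generating function of a Poisson count, summed by the exponential
  series. Second moments and Chernoff bounds both reduce to it.\<close>

lemma nn_integral_power_poisson_measure:
  assumes m: "0 \<le> m" and c: "0 \<le> c"
  shows "(\<integral>\<^sup>+ x. ennreal (c ^ count_of x) \<partial>poisson_measure (ennreal m)) =
    ennreal (exp (m * (c - 1)))"
proof -
  have "(\<integral>\<^sup>+ x. ennreal (c ^ count_of x) \<partial>poisson_measure (ennreal m)) =
      (\<Sum>k. ennreal (exp (- m) * ((m * c) ^ k /\<^sub>R fact k)))"
    using m c
    by (subst nn_integral_poisson_measure)
       (auto simp: ennreal_mult[symmetric] field_simps power_mult_distrib intro!: suminf_cong)
  also have "\<dots> = ennreal (exp (- m) * exp (m * c))"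
    using m c by (intro suminf_ennreal_eq sums_mult exp_converges) auto
  also have "exp (- m) * exp (m * c) = exp (m * (c - 1))"
    by (simp add: exp_add[symmetric] algebra_simps)
  finally show ?thesis .
qed

text \<open>The density is the quotient of the two Poisson weights at \<open>k\<close>. The
  hypothesis \<open>ac\<close> is what absolute continuity demands at the degenerate mean
  \<open>m = 0\<close>.\<close>

lemma poisson_measure_density:
  assumes l: "0 \<le> l" and m: "0 \<le> m" and ac: "m = 0 \<Longrightarrow> l = 0"
  shows "poisson_measure (ennreal l) =
    density (poisson_measure (ennreal m)) (\<lambda>x. ennreal (exp (m - l) * (l / m) ^ count_of x))"
proof (rule measure_eqI)
  fix A assume "A \<in> sets (poisson_measure (ennreal l))"
  then have [measurable]: "A \<in> sets borel" by simp
  \<comment> \<open>For \<open>m = 0\<close> also \<open>l = 0\<close>, and \<open>l / m = 0\<close>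
    by the convention on division, so both sides are the weights of the point mass at
    \<open>0\<close>.\<close>
  have w: "m ^ k / fact k * exp (- m) * (exp (m - l) * (l / m) ^ k) = l ^ k / fact k * exp (- l)" for k
  proof (cases "m = 0")
    case False
    then have "m ^ k / fact k * exp (- m) * (exp (m - l) * (l / m) ^ k) =
        (m * (l / m)) ^ k / fact k * exp (- m + (m - l))"
      by (simp only: power_mult_distrib exp_add) simp
    then show ?thesis using False by simp
  qed (use ac in \<open>cases k; simp\<close>)
  have "emeasure (density (poisson_measure (ennreal m))
          (\<lambda>x. ennreal (exp (m - l) * (l / m) ^ count_of x))) A =
      (\<Sum>k. ennreal (m ^ k / fact k * exp (- m)) *
        (ennreal (exp (m - l) * (l / m) ^ k) * indicator A (of_nat k)))"
    using m by (subst emeasure_density) (auto simp: nn_integral_poisson_measure)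
  also have "\<dots> = (\<Sum>k. ennreal (l ^ k / fact k * exp (- l)) * indicator A (of_nat k))"
  proof (rule suminf_cong)
    fix k
    have "ennreal (l ^ k / fact k * exp (- l)) =
        ennreal (m ^ k / fact k * exp (- m)) * ennreal (exp (m - l) * (l / m) ^ k)"
      unfolding w[symmetric] using m l by (intro ennreal_mult) auto
    then show "ennreal (m ^ k / fact k * exp (- m)) * (ennreal (exp (m - l) * (l / m) ^ k) * indicator A (of_nat k)) =
        ennreal (l ^ k / fact k * exp (- l)) * indicator A (of_nat k)"
      by (simp only: mult.assoc)
  qed
  also have "\<dots> = emeasure (poisson_measure (ennreal l)) A"
    using l nn_integral_poisson_measure[of l "indicator A"] by simp
  finally show "emeasure (poisson_measure (ennreal l)) A = emeasure (density (poisson_measure (ennreal m))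
    (\<lambda>x. ennreal (exp (m - l) * (l / m) ^ count_of x))) A" ..
qed simp

text \<open>The squared density is a constant times a power with base
  \<open>(l / m)\<^sup>2\<close>, so the generating function applies.\<close>

lemma nn_integral_poisson_density_square:
  assumes l: "0 \<le> l" and m: "0 \<le> m" and ac: "m = 0 \<Longrightarrow> l = 0"
  shows "(\<integral>\<^sup>+ x. (ennreal (exp (m - l) * (l / m) ^ count_of x))\<^sup>2 \<partial>poisson_measure (ennreal m)) =
    ennreal (exp ((l - m)\<^sup>2 / m))"
proof -
  have "(\<integral>\<^sup>+ x. (ennreal (exp (m - l) * (l / m) ^ count_of x))\<^sup>2 \<partial>poisson_measure (ennreal m)) =
      (\<integral>\<^sup>+ x. ennreal (exp (2 * (m - l))) * ennreal (((l / m)\<^sup>2) ^ count_of x) \<partial>poisson_measure (ennreal m))"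
    using l m
    by (intro nn_integral_cong)
       (simp add: ennreal_power ennreal_mult[symmetric] power_mult_distrib exp_double[symmetric]
         power_mult[symmetric] mult.commute[of 2] del: power_divide)
  also have "\<dots> = ennreal (exp (2 * (m - l)) * exp (m * ((l / m)\<^sup>2 - 1)))"
    using l m by (subst nn_integral_cmult) (auto simp: nn_integral_power_poisson_measure ennreal_mult)
  also have "exp (2 * (m - l)) * exp (m * ((l / m)\<^sup>2 - 1)) = exp ((l - m)\<^sup>2 / m)"
    using ac by (cases "m = 0") (auto simp: exp_add[symmetric] field_simps power2_eq_square)
  finally show ?thesis .
qed

section \<open>Densities on finite products\<close>

text \<open>On rectangles the integral of the product of densities factorises, and rectangles
  determine a product measure.\<close>

lemma PiM_density:
  assumes I: "finite I"
    and M: "\<And>i. sigma_finite_measure (M i)"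
    and N: "\<And>i. sigma_finite_measure (density (M i) (f i))"
    and f: "\<And>i. f i \<in> borel_measurable (M i)"
  shows "PiM I (\<lambda>i. density (M i) (f i)) = density (PiM I M) (\<lambda>x. \<Prod>i\<in>I. f i (x i))"
proof -
  interpret M: product_sigma_finite M by (simp add: product_sigma_finite_def M)
  interpret N: product_sigma_finite "\<lambda>i. density (M i) (f i)" by (simp add: product_sigma_finite_def N)
  note f [measurable]
  show ?thesis
  proof (rule N.PiM_eqI[OF I, symmetric])
    show "sets (density (PiM I M) (\<lambda>x. \<Prod>i\<in>I. f i (x i))) = sets (PiM I (\<lambda>i. density (M i) (f i)))"
      by (simp, rule sets_PiM_cong) auto
    fix A assume "\<And>i. i \<in> I \<Longrightarrow> A i \<in> sets (density (M i) (f i))"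
    then have A [measurable]: "\<And>i. i \<in> I \<Longrightarrow> A i \<in> sets (M i)" by simp
    have "emeasure (density (PiM I M) (\<lambda>x. \<Prod>i\<in>I. f i (x i))) (Pi\<^sub>E I A) =
        (\<integral>\<^sup>+ x. (\<Prod>i\<in>I. f i (x i)) * indicator (Pi\<^sub>E I A) x \<partial>PiM I M)"
      using I by (intro emeasure_density sets_PiM_I_finite A) auto
    also have "\<dots> = (\<integral>\<^sup>+ x. (\<Prod>i\<in>I. f i (x i) * indicator (A i) (x i)) \<partial>PiM I M)"
    proof (rule nn_integral_cong)
      fix x assume x: "x \<in> space (PiM I M)"
      show "(\<Prod>i\<in>I. f i (x i)) * indicator (Pi\<^sub>E I A) x = (\<Prod>i\<in>I. f i (x i) * indicator (A i) (x i))"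
      proof (cases "x \<in> Pi\<^sub>E I A")
        case True
        then have "\<And>i. i \<in> I \<Longrightarrow> x i \<in> A i" by auto
        then show ?thesis using True by simp
      next
        case False
        then obtain i where "i \<in> I" "x i \<notin> A i"
          using x by (auto simp: space_PiM PiE_def)
        then have "(\<Prod>i\<in>I. f i (x i) * indicator (A i) (x i)) = 0"
          using I by (intro prod_zero bexI[of _ i]) auto
        then show ?thesis using False by simp
      qed
    qed
    also have "\<dots> = (\<Prod>i\<in>I. \<integral>\<^sup>+ x. f i x * indicator (A i) x \<partial>M i)"
      using I by (intro M.product_nn_integral_prod) auto
    also have "\<dots> = (\<Prod>i\<in>I. emeasure (density (M i) (f i)) (A i))"
      by (intro prod.cong) (auto simp: emeasure_density)
    finally show "emeasure (density (PiM I M) (\<lambda>x. \<Prod>i\<in>I. f i (x i))) (Pi\<^sub>E I A) =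
        (\<Prod>i\<in>I. emeasure (density (M i) (f i)) (A i))" .
  qed
qed

text \<open>The \<open>f i\<close> truncate the laws \<open>p i\<close>; the truncated product law
  has the product of the \<open>z i\<close> as density with respect to the product of the
  \<open>q i\<close>. Cauchy--Schwarz against the indicator of \<open>G\<close> then splits off the
  second moments, which factorise. The bound \<open>f i x \<le> 1\<close> keeps the truncated laws
  finite, as \<open>PiM_density\<close> asks for sigma-finite measures.\<close>

lemma PiM_density_square_le:
  assumes I: "finite I"
    and q: "\<And>i. prob_space (q i)" and p: "\<And>i. prob_space (p i)"
    and f: "\<And>i. f i \<in> borel_measurable (p i)" "\<And>i x. f i x \<le> 1"
    and z: "\<And>i. z i \<in> borel_measurable (q i)"
    and eq: "\<And>i. density (p i) (f i) = density (q i) (z i)"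
    and G: "G \<in> sets (PiM I q)"
  shows "(\<integral>\<^sup>+ x. (\<Prod>i\<in>I. f i (x i)) * indicator G x \<partial>PiM I p)\<^sup>2 \<le>
    (\<Prod>i\<in>I. \<integral>\<^sup>+ x. (z i x)\<^sup>2 \<partial>q i) * emeasure (PiM I q) G"
proof -
  have [measurable_cong]: "sets (p i) = sets (q i)" for i
    using arg_cong[OF eq, of sets i] by simp
  have s: "sets (PiM I p) = sets (PiM I q)" by (intro sets_PiM_cong) (auto simp: \<open>\<And>i. sets (p i) = sets (q i)\<close>)
  have sf: "sigma_finite_measure (p i)" "sigma_finite_measure (q i)" for i
    using p q by (auto intro: prob_space_imp_sigma_finite)
  have fd: "finite_measure (density (p i) (f i))" for i
  proof
    interpret prob_space "p i" by (rule p)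
    have "(\<integral>\<^sup>+ x. f i x * indicator (space (p i)) x \<partial>p i) \<le> (\<integral>\<^sup>+ x. 1 \<partial>p i)"
      using f by (intro nn_integral_mono) (auto simp: indicator_def)
    also have "\<dots> = 1" by (simp add: emeasure_space_1)
    finally show "emeasure (density (p i) (f i)) (space (density (p i) (f i))) \<noteq> \<infinity>"
      using f by (auto simp: emeasure_density top_unique)
  qed
  then have dd: "sigma_finite_measure (density (p i) (f i))" for i
    by (simp add: finite_measure.axioms)
  then have dz: "sigma_finite_measure (density (q i) (z i))" for i using eq by simp
  interpret q: product_sigma_finite q by (simp add: product_sigma_finite_def sf)
  note [measurable] = f(1) z G G[folded s]
  have "(\<integral>\<^sup>+ x. (\<Prod>i\<in>I. f i (x i)) * indicator G x \<partial>PiM I p) =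
      emeasure (density (PiM I p) (\<lambda>x. \<Prod>i\<in>I. f i (x i))) G"
    by (rule emeasure_density[symmetric]) auto
  also have "\<dots> = emeasure (density (PiM I q) (\<lambda>x. \<Prod>i\<in>I. z i (x i))) G"
    using PiM_density[OF I sf(1) dd f(1)] PiM_density[OF I sf(2) dz z] eq by simp
  also have "\<dots> = (\<integral>\<^sup>+ x. (\<Prod>i\<in>I. z i (x i)) * indicator G x \<partial>PiM I q)"
    by (rule emeasure_density) auto
  finally have "(\<integral>\<^sup>+ x. (\<Prod>i\<in>I. f i (x i)) * indicator G x \<partial>PiM I p)\<^sup>2 \<le>
      (\<integral>\<^sup>+ x. (\<Prod>i\<in>I. z i (x i))\<^sup>2 \<partial>PiM I q) * (\<integral>\<^sup>+ x. (indicator G x)\<^sup>2 \<partial>PiM I q)"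
    by (simp add: Cauchy_Schwarz_nn_integral)
  also have "(\<integral>\<^sup>+ x. (indicator G x)\<^sup>2 \<partial>PiM I q) = emeasure (PiM I q) G"
    by (simp add: indicator_def power2_eq_square flip: nn_integral_indicator of_bool_conj)
  also have "(\<integral>\<^sup>+ x. (\<Prod>i\<in>I. z i (x i))\<^sup>2 \<partial>PiM I q) = (\<Prod>i\<in>I. \<integral>\<^sup>+ x. (z i x)\<^sup>2 \<partial>q i)"
    by (subst prod_power_distrib, rule q.product_nn_integral_prod) (use I in auto)
  finally show ?thesis .
qed

section \<open>Likelihood ratio of the count of a single cell\<close>

text \<open>For cells inside \<open>D\<close>: restricted to the event of no point, the two laws
  differ by the factor \<open>exp (m - l)\<close>. The second moment equals
  \<open>exp (m - 2 * l)\<close>, which is bounded without control of \<open>l\<close>.\<close>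

lemma poisson_void_density:
  assumes l: "0 \<le> l" and m: "0 \<le> m"
  shows "density (poisson_measure (ennreal l)) (indicator {0}) =
      density (poisson_measure (ennreal m)) (\<lambda>x. ennreal (exp (m - l)) * indicator {0} x)"
    and "(\<integral>\<^sup>+ x. (ennreal (exp (m - l)) * indicator {0} x)\<^sup>2 \<partial>poisson_measure (ennreal m)) \<le> ennreal (exp m)"
proof -
  \<comment> \<open>Only the weight at \<open>k = 0\<close> survives, so both claims become
    identities between exponentials.\<close>
  have n: "(\<integral>\<^sup>+ x. g x * indicator {0} x \<partial>poisson_measure (ennreal r)) = ennreal (exp (- r)) * g 0"
    if "0 \<le> r" and [measurable]: "g \<in> borel_measurable borel" for r and g :: "ennreal \<Rightarrow> ennreal"
  proof -
    have "(\<integral>\<^sup>+ x. g x * indicator {0} x \<partial>poisson_measure (ennreal r)) =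
        (\<Sum>k. ennreal (r ^ k / fact k * exp (- r)) * (g (of_nat k) * indicator {0} (of_nat k :: ennreal)))"
      using that by (subst nn_integral_poisson_measure) auto
    also have "\<dots> = (\<Sum>k\<in>{0}. ennreal (r ^ k / fact k * exp (- r)) * (g (of_nat k) * indicator {0} (of_nat k :: ennreal)))"
      by (rule suminf_finite) (auto simp: indicator_def)
    finally show ?thesis by simp
  qed
  show "density (poisson_measure (ennreal l)) (indicator {0}) =
      density (poisson_measure (ennreal m)) (\<lambda>x. ennreal (exp (m - l)) * indicator {0} x)"
  proof (rule measure_eqI)
    fix A assume "A \<in> sets (density (poisson_measure (ennreal l)) (indicator {0}))"
    then have [measurable]: "A \<in> sets borel" by simp
    have "emeasure (density (poisson_measure (ennreal l)) (indicator {0})) A =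
        (\<integral>\<^sup>+ x. indicator A x * indicator {0} x \<partial>poisson_measure (ennreal l))"
      by (subst emeasure_density) (auto simp: mult.commute)
    also have "\<dots> = (\<integral>\<^sup>+ x. (ennreal (exp (m - l)) * indicator A x) * indicator {0} x \<partial>poisson_measure (ennreal m))"
      using l m n[of l "indicator A"] n[of m "\<lambda>x. ennreal (exp (m - l)) * indicator A x"]
      by (simp add: mult.assoc[symmetric] ennreal_mult[symmetric] exp_add[symmetric]
          del: nn_integral_indicator_singleton nn_integral_indicator_singleton')
    also have "\<dots> = emeasure (density (poisson_measure (ennreal m)) (\<lambda>x. ennreal (exp (m - l)) * indicator {0} x)) A"
      by (subst emeasure_density) (auto simp: mult_ac)
    finally show "emeasure (density (poisson_measure (ennreal l)) (indicator {0})) A =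
      emeasure (density (poisson_measure (ennreal m)) (\<lambda>x. ennreal (exp (m - l)) * indicator {0} x)) A" .
  qed simp
  have "(\<integral>\<^sup>+ x. (ennreal (exp (m - l)) * indicator {0} x)\<^sup>2 \<partial>poisson_measure (ennreal m)) =
      (\<integral>\<^sup>+ x. ennreal (exp (2 * (m - l))) * indicator {0} x \<partial>poisson_measure (ennreal m))"
    by (intro nn_integral_cong) (auto simp: indicator_def ennreal_power exp_double[symmetric] right_diff_distrib)
  also have "\<dots> = ennreal (exp (- m + 2 * (m - l)))"
    using m n[of m "\<lambda>_. ennreal (exp (2 * (m - l)))"]
    by (simp add: ennreal_mult[symmetric] exp_add[symmetric]
        del: nn_integral_indicator_singleton nn_integral_indicator_singleton')
  also have "\<dots> \<le> ennreal (exp m)" using l by simp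
  finally show "(\<integral>\<^sup>+ x. (ennreal (exp (m - l)) * indicator {0} x)\<^sup>2 \<partial>poisson_measure (ennreal m)) \<le> ennreal (exp m)" .
qed

text \<open>For cells outside \<open>D\<close>: with finite means, the exponent
  \<open>(l - m)\<^sup>2 / m\<close> is at most \<open>\<kappa>\<close> by Cauchy--Schwarz for the
  integral of \<open>f - 1\<close> over \<open>C\<close>. If \<open>mu C\<close> is infinite, so is
  \<open>lam C\<close>; both counts are then almost surely infinite and the likelihood ratio is
  \<open>1\<close>.\<close>

lemma poisson_measure_density_set:
  fixes f :: "'a \<Rightarrow> real"
  assumes f [measurable]: "f \<in> borel_measurable mu" and nn: "\<And>x. 0 \<le> f x"
    and lam: "lam = density mu (\<lambda>x. ennreal (f x))"
    and C [measurable]: "C \<in> sets mu"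
    and \<kappa>: "(\<integral>\<^sup>+ x. ennreal ((f x - 1)\<^sup>2) * indicator C x \<partial>mu) = ennreal \<kappa>" "0 \<le> \<kappa>"
  obtains z where "z \<in> borel_measurable borel"
    "poisson_measure (emeasure lam C) = density (poisson_measure (emeasure mu C)) z"
    "(\<integral>\<^sup>+ x. (z x)\<^sup>2 \<partial>poisson_measure (emeasure mu C)) \<le> ennreal (exp \<kappa>)"
proof -
  have lamC: "emeasure lam C = (\<integral>\<^sup>+ x. ennreal (f x) * indicator C x \<partial>mu)"
    by (simp add: lam emeasure_density)
  \<comment> \<open>Integrates over \<open>C\<close> an inequality that is linear in
    \<open>y\<close> and \<open>(y - 1)\<^sup>2\<close>, at \<open>y = f x\<close>. Nonnegative
    coefficients on both sides avoid subtraction of possibly infinite masses. Every estimate below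
    is an instance.\<close>
  have mono: "ennreal a * emeasure mu C + ennreal b * emeasure lam C \<le>
      ennreal c * ennreal \<kappa> + ennreal a' * emeasure mu C + ennreal b' * emeasure lam C"
    if "0 \<le> a" "0 \<le> b" "0 \<le> c" "0 \<le> a'" "0 \<le> b'"
      and le: "\<And>y. 0 \<le> y \<Longrightarrow> a + b * y \<le> c * (y - 1)\<^sup>2 + a' + b' * y" for a b c a' b'
  proof -
    have "ennreal a * emeasure mu C + ennreal b * emeasure lam C =
        (\<integral>\<^sup>+ x. ennreal a * indicator C x + ennreal b * (ennreal (f x) * indicator C x) \<partial>mu)"
      by (simp add: nn_integral_add nn_integral_cmult lamC)
    also have "\<dots> \<le> (\<integral>\<^sup>+ x. ennreal c * (ennreal ((f x - 1)\<^sup>2) * indicator C x) +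
        ennreal a' * indicator C x + ennreal b' * (ennreal (f x) * indicator C x) \<partial>mu)"
      using that nn by (intro nn_integral_mono)
        (auto simp: indicator_def ennreal_mult[symmetric] ennreal_plus[symmetric] simp del: ennreal_plus)
    also have "\<dots> = ennreal c * ennreal \<kappa> + ennreal a' * emeasure mu C + ennreal b' * emeasure lam C"
      by (simp add: nn_integral_add nn_integral_cmult lamC \<kappa>)
    finally show ?thesis .
  qed
  show ?thesis
  proof (cases "emeasure mu C = \<infinity>")
    case True
    \<comment> \<open>Either \<open>y\<close> is at least \<open>1/2\<close> or its distance to
      \<open>1\<close> is, so \<open>1 \<le> 4 * (y - 1)\<^sup>2 + 2 * y\<close>. After integration
      an infinite \<open>mu C\<close> forces an infinite \<open>lam C\<close>.\<close>
    have half: "y \<ge> 1/2 \<or> (1/2)\<^sup>2 \<le> (y - 1)\<^sup>2" for y :: real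
      using power_mono[of "1/2" "1 - y" 2] power2_commute[of y 1] by linarith
    have "1 + 0 * y \<le> 4 * (y - 1)\<^sup>2 + 0 + 2 * y" if "0 \<le> y" for y :: real
      using half[of y] unfolding power_divide
    proof
      assume "1 / 2 \<le> y"
      then show ?thesis using zero_le_power2[of "y - 1"] by linarith
    next
      assume "1\<^sup>2 / 2\<^sup>2 \<le> (y - 1)\<^sup>2"
      then have "1 \<le> 4 * (y - 1)\<^sup>2" by simp
      then show ?thesis using that by linarith
    qed
    from mono[of 1 0 4 0 2, OF _ _ _ _ _ this] have "emeasure lam C = \<infinity>"
      using True by (simp add: top_unique ennreal_mult_eq_top_iff ennreal_mult[symmetric] \<kappa>)
    then show ?thesis
      using True \<kappa>(2) by (intro that[of "\<lambda>_. 1"])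
        (auto simp: density_1 prob_space.emeasure_space_1[OF prob_space_poisson_measure])
  next
    case False
    \<comment> \<open>Conversely, this inequality bounds \<open>lam C\<close> by
      \<open>\<kappa>\<close> and \<open>mu C\<close>, so both means are finite.\<close>
    have "0 + 1 * y \<le> 1 * (y - 1)\<^sup>2 + 2 + 0 * y" for y :: real
      using zero_le_power2[of "y - 3/2"] by (simp add: power2_eq_square algebra_simps)
    from mono[of 0 1 1 2 0, OF _ _ _ _ _ this] have le: "emeasure lam C \<le> ennreal \<kappa> + 2 * emeasure mu C" by simp
    also have "\<dots> < \<infinity>" using False by (simp add: ennreal_mult_less_top less_top)
    finally have "emeasure lam C < \<infinity>" .
    then obtain l m where l: "emeasure lam C = ennreal l" "0 \<le> l" and m: "emeasure mu C = ennreal m" "0 \<le> m"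
      using False by (metis ennreal_cases less_irrefl infinity_ennreal_def)
    have ac: "l = 0" if "m = 0"
    proof -
      have "C \<in> null_sets mu" using that m by auto
      then have "C \<in> null_sets lam" unfolding lam by (subst null_sets_density_iff) (auto dest: AE_not_in)
      then show ?thesis using l by auto
    qed
    have "(l - m)\<^sup>2 / m \<le> \<kappa>"
    proof (cases "m = 0")
      case False
      then have m0: "0 < m" using m by simp
      \<comment> \<open>\<open>t\<close> is the \<open>mu\<close>-average of \<open>f - 1\<close>
        over \<open>C\<close>. The tangent bound
        \<open>(y - 1)\<^sup>2 \<ge> 2 * t * (y - 1) - t\<^sup>2\<close> is sharpest for this slope
        and integrates to the Cauchy--Schwarz estimate.\<close>
      define t where "t = (l - m) / m"
      have tm: "t * m = l - m" using m0 by (simp add: t_def)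
      have "2 * t * (l - m) \<le> \<kappa> + t\<^sup>2 * m"
      \<comment> \<open>The sign of \<open>t\<close> decides on which side the term in
        \<open>y\<close> stands, since \<open>mono\<close> takes nonnegative coefficients.\<close>
      proof (cases "0 \<le> t")
        case True
        have "0 + (2 * t) * y \<le> 1 * (y - 1)\<^sup>2 + (2 * t + t\<^sup>2) + 0 * y" for y :: real
          using zero_le_power2[of "y - 1 - t"] by (simp add: power2_eq_square algebra_simps)
        from mono[of 0 "2 * t" 1 "2 * t + t\<^sup>2" 0, OF _ _ _ _ _ this] True l m \<kappa>(2) show ?thesis
          by (simp add: ennreal_mult[symmetric] ennreal_plus[symmetric] algebra_simps del: ennreal_plus)
      next
        case False
        have "(- 2 * t) + 0 * y \<le> 1 * (y - 1)\<^sup>2 + t\<^sup>2 + (- 2 * t) * y" for y :: real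
          using zero_le_power2[of "y - 1 - t"] by (simp add: power2_eq_square algebra_simps)
        from mono[of "- 2 * t" 0 1 "t\<^sup>2" "- 2 * t", OF _ _ _ _ _ this] False l m \<kappa>(2)
        have "ennreal (- 2 * t * m) \<le> ennreal (\<kappa> + t\<^sup>2 * m + - 2 * t * l)"
          by (simp add: ennreal_mult[symmetric] ennreal_plus[symmetric] mult_nonpos_nonneg del: ennreal_plus)
        moreover have "0 \<le> \<kappa> + t\<^sup>2 * m + - 2 * t * l"
          using False l m \<kappa>(2) mult_nonneg_nonpos[of l t] by (intro add_nonneg_nonneg) (auto simp: mult.commute)
        ultimately show ?thesis by (simp add: algebra_simps)
      qed
      moreover have "(l - m)\<^sup>2 / m = 2 * t * (l - m) - t\<^sup>2 * m"
        using m0 by (simp add: t_def field_simps power2_eq_square)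
      ultimately show ?thesis by simp
    qed (use \<kappa> in simp)
    then show ?thesis
      using that[of "\<lambda>x. ennreal (exp (m - l) * (l / m) ^ count_of x)"]
        poisson_measure_density[OF l(2) m(2) ac] nn_integral_poisson_density_square[OF l(2) m(2) ac]
      by (simp add: l m)
  qed
qed

section \<open>Cylinder sets\<close>

text \<open>The approximable sets contain the algebra and are closed under complements and countable
  unions; induction over \<open>sigma_sets\<close> checks this.\<close>

lemma (in finite_measure) algebra_approximation:
  assumes alg: "algebra (space M) \<A>" and gen: "sets M = sigma_sets (space M) \<A>"
    and A: "A \<in> sets M" and e: "0 < e"
  shows "\<exists>B\<in>\<A>. measure M (sym_diff A B) < e"
proof -
  interpret \<A>: algebra "space M" \<A> by (rule alg)
  have sub [measurable_dest]: "B \<in> \<A> \<Longrightarrow> B \<in> sets M" for B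
    unfolding gen by (rule sigma_sets.Basic)
  from A have "A \<in> sigma_sets (space M) \<A>" by (simp add: gen)
  then show ?thesis using e
  proof (induction arbitrary: e)
    case (Basic A)
    then show ?case by (intro bexI[of _ A]) auto
  next
    case Empty
    then show ?case by (intro bexI[of _ "{}"]) auto
  next
    case (Compl A)
    then obtain B where B: "B \<in> \<A>" "measure M (sym_diff A B) < e" by blast
    have "A \<subseteq> space M" "B \<subseteq> space M"
      using Compl(1) sets.sets_into_space[OF sub[OF B(1)]] sets.sets_into_space[of A M]
      by (simp_all add: gen)
    then have "sym_diff (space M - A) (space M - B) = sym_diff A B" by blast
    then show ?case using B by (intro bexI[of _ "space M - B"]) auto
  next
    case (Union a)
    have a: "\<And>i. a i \<in> sets M" using Union(1) by (simp add: gen)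
    \<comment> \<open>Half of the error is shared geometrically among the sets \<open>a i\<close>;
      the other half pays for cutting the union down to finitely many of them.\<close>
    have "\<forall>i. \<exists>B\<in>\<A>. measure M (sym_diff (a i) B) < e / 2 * (1 / 2) ^ Suc i"
      using Union(3) by (intro allI Union(2)) simp
    then obtain B where B: "\<And>i. B i \<in> \<A>"
      "\<And>i. measure M (sym_diff (a i) (B i)) < e / 2 * (1 / 2) ^ Suc i" by metis
    have B': "B i \<in> sets M" for i using B(1) sub by simp
    have "(\<lambda>n. measure M (\<Union>i<n. a i)) \<longlonglongrightarrow> measure M (\<Union>n. \<Union>i<n. a i)"
      by (intro finite_Lim_measure_incseq) (auto simp: incseq_def a intro!: less_le_trans)
    moreover have "(\<Union>n. \<Union>i<n. a i) = (\<Union>i. a i)" by auto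
    ultimately have "(\<lambda>n. measure M (\<Union>i<n. a i)) \<longlonglongrightarrow> measure M (\<Union>i. a i)" by simp
    then have "\<forall>\<^sub>F n in sequentially. dist (measure M (\<Union>i<n. a i)) (measure M (\<Union>i. a i)) < e / 2"
      by (rule tendstoD) (use Union(3) in simp)
    then obtain n where n: "dist (measure M (\<Union>i<n. a i)) (measure M (\<Union>i. a i)) < e / 2"
      by (auto simp: eventually_sequentially)
    have d: "measure M ((\<Union>i. a i) - (\<Union>i<n. a i)) < e / 2"
    proof -
      have "measure M ((\<Union>i. a i) - (\<Union>i<n. a i)) = measure M (\<Union>i. a i) - measure M (\<Union>i<n. a i)"
        using a by (intro finite_measure_Diff) auto
      then show ?thesis using n unfolding dist_real_def by linarith
    qed
    have "measure M (sym_diff (\<Union>i. a i) (\<Union>i<n. B i)) \<le>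
        measure M (((\<Union>i. a i) - (\<Union>i<n. a i)) \<union> (\<Union>i<n. sym_diff (a i) (B i)))"
      by (intro finite_measure_mono) (use a B' in auto)
    also have "\<dots> \<le> measure M ((\<Union>i. a i) - (\<Union>i<n. a i)) + measure M (\<Union>i<n. sym_diff (a i) (B i))"
      by (intro measure_Un_le) (use a B' in auto)
    also have "measure M (\<Union>i<n. sym_diff (a i) (B i)) \<le> (\<Sum>i<n. measure M (sym_diff (a i) (B i)))"
      by (intro measure_UNION_le) (use a B' in auto)
    also have "\<dots> \<le> (\<Sum>i<n. e / 2 * (1 / 2) ^ Suc i)"
      using B(2) by (intro sum_mono less_imp_le)
    also have "\<dots> \<le> (\<Sum>i. e / 2 * (1 / 2) ^ Suc i)"
      using Union(3) sums_mult[OF power_half_series, of "e / 2"]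
      by (intro sum_le_suminf) (auto simp: sums_iff)
    also have "\<dots> = e / 2"
      using sums_mult[OF power_half_series, of "e / 2"] by (simp add: sums_iff)
    finally have "measure M (sym_diff (\<Union>i. a i) (\<Union>i<n. B i)) < e"
      using d by simp
    moreover have "(\<Union>i<n. B i) \<in> \<A>" using B(1) by auto
    ultimately show ?case by blast
  qed
qed

section \<open>Events determined by finitely many counts\<close>

text \<open>The events depending only on the counts of the sets in \<open>\<B>\<close>. The counts
  are indexed by the sets themselves, so enlarging \<open>\<B>\<close> is a mere restriction of
  vectors; the pullback makes each family a sigma-algebra.\<close>

definition cylinders :: "'a measure \<Rightarrow> 'a set set \<Rightarrow> 'a measure set set" where
  "cylinders S \<B> = sets (vimage_algebra (point_patterns S) (\<lambda>\<eta>. \<lambda>B\<in>\<B>. emeasure \<eta> B) (PiM \<B> (\<lambda>_. borel)))"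

lemma cylinders_iff:
  "A \<in> cylinders S \<B> \<longleftrightarrow>
    (\<exists>G\<in>sets (PiM \<B> (\<lambda>_. borel)). A = {\<eta>\<in>point_patterns S. (\<lambda>B\<in>\<B>. emeasure \<eta> B) \<in> G})"
  unfolding cylinders_def
  by (subst sets_vimage_algebra2) (auto simp: space_PiM)

lemma cylinders_mono:
  assumes "\<B> \<subseteq> \<B>'"
  shows "cylinders S \<B> \<subseteq> cylinders S \<B>'"
proof
  fix A assume "A \<in> cylinders S \<B>"
  then obtain G where G: "G \<in> sets (PiM \<B> (\<lambda>_. borel))"
    "A = {\<eta>\<in>point_patterns S. (\<lambda>B\<in>\<B>. emeasure \<eta> B) \<in> G}" by (auto simp: cylinders_iff)
  let ?G = "(\<lambda>v. restrict v \<B>) -` G \<inter> space (PiM \<B>' (\<lambda>_. borel :: ennreal measure))"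
  have "?G \<in> sets (PiM \<B>' (\<lambda>_. borel))"
    using G(1) assms by (intro measurable_sets[OF measurable_restrict_subset])
  moreover have "restrict (restrict (emeasure \<eta>) \<B>') \<B> = restrict (emeasure \<eta>) \<B>" for \<eta> :: "'a measure"
    using assms by (simp add: Int_absorb1)
  then have "A = {\<eta>\<in>point_patterns S. (\<lambda>B\<in>\<B>'. emeasure \<eta> B) \<in> ?G}"
    by (auto simp: G(2) space_PiM)
  ultimately show "A \<in> cylinders S \<B>'" unfolding cylinders_iff by blast
qed

text \<open>Two cylinders are both cylinders over the union of their index sets, and over a fixed
  index set the sigma-algebra operations are available.\<close>

lemma algebra_cylinders:
  "algebra (point_patterns S) (\<Union>\<B>\<in>{\<B>. finite \<B> \<and> \<B> \<subseteq> sets S}. cylinders S \<B>)"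
  (is "algebra _ ?A")
proof -
  have sa: "sigma_algebra (point_patterns S) (cylinders S \<B>)" for \<B>
    unfolding cylinders_def using sets.sigma_algebra_axioms
      [of "vimage_algebra (point_patterns S) (\<lambda>\<eta>. \<lambda>B\<in>\<B>. emeasure \<eta> B) (PiM \<B> (\<lambda>_. borel))"]
    by simp
  show ?thesis
  proof (rule algebra_iff_Un[THEN iffD2], intro conjI ballI)
    show "?A \<subseteq> Pow (point_patterns S)" by (auto simp: cylinders_iff)
    show "{} \<in> ?A"
      using sa[of "{}"] by (intro UN_I[of "{}"]) (auto simp: sigma_algebra_iff2)
  next
    fix A assume "A \<in> ?A"
    then obtain \<B> where "finite \<B>" "\<B> \<subseteq> sets S" "A \<in> cylinders S \<B>" by auto
    moreover then have "point_patterns S - A \<in> cylinders S \<B>"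
      using sa[of \<B>] by (simp add: sigma_algebra_iff2)
    ultimately show "point_patterns S - A \<in> ?A" by auto
  next
    fix A A' assume "A \<in> ?A" "A' \<in> ?A"
    then obtain \<B> \<B>' where B: "finite \<B>" "\<B> \<subseteq> sets S" "A \<in> cylinders S \<B>"
      "finite \<B>'" "\<B>' \<subseteq> sets S" "A' \<in> cylinders S \<B>'" by auto
    then have "A \<in> cylinders S (\<B> \<union> \<B>')" "A' \<in> cylinders S (\<B> \<union> \<B>')"
      using cylinders_mono[of \<B> "\<B> \<union> \<B>'" S] cylinders_mono[of \<B>' "\<B> \<union> \<B>'" S] by auto
    then have "A \<union> A' \<in> cylinders S (\<B> \<union> \<B>')"
      using sa[of "\<B> \<union> \<B>'"] unfolding sigma_algebra_def algebra_iff_Un by blast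
    then show "A \<union> A' \<in> ?A" using B by auto
  qed
qed

text \<open>One-element index sets give the evaluation maps; conversely each finite vector of counts
  is measurable.\<close>

lemma sets_point_pattern_algebra_cylinders:
  "sets (point_pattern_algebra S) =
    sigma_sets (point_patterns S) (\<Union>\<B>\<in>{\<B>. finite \<B> \<and> \<B> \<subseteq> sets S}. cylinders S \<B>)"
proof
  let ?C = "\<Union>\<B>\<in>{\<B>. finite \<B> \<and> \<B> \<subseteq> sets S}. cylinders S \<B>"
  have "sets (point_pattern_algebra S) = sigma_sets (point_patterns S)
      (\<Union>x\<in>(\<lambda>B. vimage_algebra (point_patterns S) (\<lambda>\<eta>. emeasure \<eta> B) borel) ` sets S. sets x)"
    unfolding point_pattern_algebra_def by (rule sets_Sup_eq) auto
  also have "\<dots> \<subseteq> sigma_sets (point_patterns S) ?C"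
  proof (rule sigma_sets_mono', safe)
    fix B A assume B: "B \<in> sets S"
      and "A \<in> sets (vimage_algebra (point_patterns S) (\<lambda>\<eta>. emeasure \<eta> B) borel)"
    then obtain G where G: "G \<in> sets borel" "A = {\<eta>\<in>point_patterns S. emeasure \<eta> B \<in> G}"
      by (subst (asm) sets_vimage_algebra2) auto
    have "A = {\<eta>\<in>point_patterns S. (\<lambda>B\<in>{B}. emeasure \<eta> B) \<in> Pi\<^sub>E {B} (\<lambda>_. G)}"
      using G(2) by auto
    moreover have "Pi\<^sub>E {B} (\<lambda>_. G) \<in> sets (PiM {B} (\<lambda>_. borel))"
      using G(1) by (intro sets_PiM_I_finite) auto
    ultimately have "A \<in> cylinders S {B}" unfolding cylinders_iff by blast
    then show "A \<in> ?C" using B by (intro UN_I[of "{B}"]) auto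
  qed
  finally show "sets (point_pattern_algebra S) \<subseteq> sigma_sets (point_patterns S) ?C" .
next
  show "sigma_sets (point_patterns S) (\<Union>\<B>\<in>{\<B>. finite \<B> \<and> \<B> \<subseteq> sets S}. cylinders S \<B>)
      \<subseteq> sets (point_pattern_algebra S)"
    unfolding space_point_pattern_algebra[symmetric]
  proof (rule sets.sigma_sets_subset, safe)
    fix \<B> A assume "finite \<B>" and \<B>: "\<B> \<subseteq> sets S" and "A \<in> cylinders S \<B>"
    then obtain G where G: "G \<in> sets (PiM \<B> (\<lambda>_. borel))"
      "A = {\<eta>\<in>point_patterns S. (\<lambda>B\<in>\<B>. emeasure \<eta> B) \<in> G}" by (auto simp: cylinders_iff)
    have "(\<lambda>\<eta>. \<lambda>B\<in>\<B>. emeasure \<eta> B) \<in> measurable (point_pattern_algebra S) (PiM \<B> (\<lambda>_. borel))"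
      using \<B> by (intro measurable_restrict measurable_emeasure_point_pattern_algebra) auto
    from measurable_sets[OF this G(1)] show "A \<in> sets (point_pattern_algebra S)"
      by (simp add: G(2) vimage_def Int_def space_point_pattern_algebra conj_commute)
  qed
qed

text \<open>Independence is given for disjoint sets only, so a cylinder is rewritten through the
  atoms of the finite algebra generated by \<open>\<B>\<close>. As \<open>D\<close> belongs to
  \<open>\<B>\<close>, each atom lies inside \<open>D\<close> or misses it.\<close>

lemma cylinder_cells:
  fixes S :: "'a measure"
  assumes A: "A \<in> cylinders S \<B>" and fin: "finite \<B>" and \<B>: "\<B> \<subseteq> sets S" and D: "D \<in> \<B>"
  obtains n C H where "1 \<le> n" "\<And>i. C i \<in> sets S" "disjoint_family_on C {1..n::nat}"
    "\<And>i. C i \<subseteq> D \<or> C i \<inter> D = {}" "H \<in> sets (PiM {1..n} (\<lambda>_. borel))"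
    "A = {\<eta>\<in>point_patterns S. (\<lambda>i\<in>{1..n}. emeasure \<eta> (C i)) \<in> H}"
proof -
  \<comment> \<open>The atom of points that lie in exactly those members of \<open>\<B>\<close> that
    belong to \<open>J\<close>. All subsets \<open>J\<close> are enumerated; some atoms may be
    empty.\<close>
  define cell where "cell J = {x\<in>space S. \<forall>B\<in>\<B>. x \<in> B \<longleftrightarrow> B \<in> J}" for J
  obtain h where h: "bij_betw h {1..card (Pow \<B>)} (Pow \<B>)"
    using ex_bij_betw_nat_finite_1 fin by (metis finite_Pow_iff)
  define n where "n = card (Pow \<B>)"
  define C where "C i = cell (h i)" for i
  note h = h[folded n_def]
  have "1 \<le> n" using fin by (simp add: n_def card_Pow)
  moreover have "cell J \<in> sets S" for J
    unfolding cell_def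
  proof (intro sets.sets_Collect_finite_All fin)
    fix B assume "B \<in> \<B>"
    then have [measurable]: "B \<in> sets S" using \<B> by auto
    show "{x\<in>space S. x \<in> B \<longleftrightarrow> B \<in> J} \<in> sets S" by measurable
  qed
  then have C: "C i \<in> sets S" for i by (simp add: C_def)
  moreover have "disjoint_family_on C {1..n::nat}"
  proof (unfold disjoint_family_on_def, intro ballI impI)
    fix i j assume ij: "i \<in> {1..n}" "j \<in> {1..n}" "i \<noteq> j"
    have "h i \<noteq> h j" using inj_onD[OF bij_betw_imp_inj_on[OF h]] ij by blast
    moreover have "h i \<subseteq> \<B>" "h j \<subseteq> \<B>" using bij_betw_apply[OF h] ij by blast+
    ultimately show "C i \<inter> C j = {}" unfolding C_def cell_def by blast
  qed
  moreover have "C i \<subseteq> D \<or> C i \<inter> D = {}" for i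
    using D unfolding C_def cell_def by blast
  moreover
  obtain G where G: "G \<in> sets (PiM \<B> (\<lambda>_. borel))"
    "A = {\<eta>\<in>point_patterns S. (\<lambda>B\<in>\<B>. emeasure \<eta> B) \<in> G}" using A by (auto simp: cylinders_iff)
  \<comment> \<open>Rebuilds the count of each \<open>B\<close> by summing the counts of the atoms
    it contains, so that the preimage of \<open>G\<close> describes \<open>A\<close> in terms of
    atoms.\<close>
  let ?t = "\<lambda>v. \<lambda>B\<in>\<B>. \<Sum>i\<in>{i\<in>{1..n}. B \<in> h i}. v i :: ennreal"
  have t: "?t \<in> measurable (PiM {1..n} (\<lambda>_. borel)) (PiM \<B> (\<lambda>_. borel))"
    by (intro measurable_restrict borel_measurable_sum measurable_component_singleton) auto
  let ?H = "?t -` G \<inter> space (PiM {1..n} (\<lambda>_. borel))"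
  have "?H \<in> sets (PiM {1..n} (\<lambda>_. borel))"
    using t G(1) by (rule measurable_sets)
  moreover have "emeasure \<eta> B = (\<Sum>i\<in>{i\<in>{1..n}. B \<in> h i}. emeasure \<eta> (C i))"
    if \<eta>: "\<eta> \<in> point_patterns S" and B: "B \<in> \<B>" for \<eta> B
  proof -
    have "B = (\<Union>i\<in>{i\<in>{1..n}. B \<in> h i}. C i)"
    proof safe
      fix x assume x: "x \<in> B"
      then have xs: "x \<in> space S" using B \<B> sets.sets_into_space by blast
      have "{B\<in>\<B>. x \<in> B} \<in> h ` {1..n}" unfolding bij_betw_imp_surj_on[OF h] by blast
      then obtain i where i: "i \<in> {1..n}" "h i = {B\<in>\<B>. x \<in> B}" by auto
      then show "x \<in> (\<Union>i\<in>{i\<in>{1..n}. B \<in> h i}. C i)"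
        using x xs B by (intro UN_I[of i]) (auto simp: C_def cell_def)
    next
      fix i x assume "x \<in> C i" "B \<in> h i"
      then show "x \<in> B" using B by (auto simp: C_def cell_def)
    qed
    then have "emeasure \<eta> B = emeasure \<eta> (\<Union>i\<in>{i\<in>{1..n}. B \<in> h i}. C i)" by simp
    also have "\<dots> = (\<Sum>i\<in>{i\<in>{1..n}. B \<in> h i}. emeasure \<eta> (C i))"
      using \<eta> C \<open>disjoint_family_on C {1..n}\<close>
      by (intro sum_emeasure[symmetric]) (auto simp: point_patterns_def elim: disjoint_family_on_mono[rotated])
    finally show ?thesis .
  qed
  then have "?t (\<lambda>i\<in>{1..n}. emeasure \<eta> (C i)) = (\<lambda>B\<in>\<B>. emeasure \<eta> B)" if "\<eta> \<in> point_patterns S" for \<eta>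
    using that by (auto simp: restrict_def fun_eq_iff intro!: sum.cong)
  then have "A = {\<eta>\<in>point_patterns S. (\<lambda>i\<in>{1..n}. emeasure \<eta> (C i)) \<in> ?H}"
    by (auto simp: G(2) space_PiM)
  ultimately show ?thesis by (rule that)
qed

section \<open>Absolute continuity for finite Hellinger distance\<close>

lemma emeasure_poisson_measure_zero:
  assumes "0 \<le> m"
  shows "emeasure (poisson_measure (ennreal m)) {0} = ennreal (exp (- m))"
proof -
  have "emeasure (poisson_measure (ennreal m)) {0} =
      (\<Sum>k. ennreal (m ^ k / fact k * exp (- m)) * indicator {0} (of_nat k :: ennreal))"
    using nn_integral_poisson_measure[OF assms, of "indicator {0}"] by simp
  also have "\<dots> = (\<Sum>k\<in>{0}. ennreal (m ^ k / fact k * exp (- m)) * indicator {0} (of_nat k :: ennreal))"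
    by (rule suminf_finite) (auto simp: indicator_def)
  finally show ?thesis by simp
qed

lemma emeasure_poisson_measure_nonzero:
  assumes "0 \<le> m"
  shows "emeasure (poisson_measure (ennreal m)) (- {0}) = ennreal (1 - exp (- m))"
proof -
  interpret prob_space "poisson_measure (ennreal m)" by (rule prob_space_poisson_measure)
  have sp: "space (poisson_measure (ennreal m)) = UNIV"
    using sets_eq_imp_space_eq[OF sets_poisson_measure] by simp
  have "prob (- {0}) = 1 - prob {0}"
    using prob_compl[of "{0}"] by (simp add: sp Compl_eq_Diff_UNIV)
  also have "prob {0} = exp (- m)"
    using emeasure_poisson_measure_zero[OF assms] by (simp add: measure_def)
  finally show ?thesis by (simp add: emeasure_eq_measure)
qed

text \<open>This is \<open>1 - exp (- r) \<le> r\<close>; it bounds the probability that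
  \<open>D\<close> contains a point by the mass of \<open>D\<close>.\<close>

lemma emeasure_poisson_measure_nonzero_le: "emeasure (poisson_measure m) (- {0}) \<le> m"
proof (cases m)
  case (real r)
  then show ?thesis
    using exp_ge_add_one_self[of "- r"] by (simp add: emeasure_poisson_measure_nonzero)
qed simp

text \<open>Through this, null sets of an intensity and null events of the process are
  matched.\<close>

lemma emeasure_poisson_measure_nonzero_eq_0_iff: "emeasure (poisson_measure m) (- {0}) = 0 \<longleftrightarrow> m = 0"
proof (cases m)
  case (real r)
  then show ?thesis by (simp add: emeasure_poisson_measure_nonzero ennreal_eq_0_iff)
qed (simp add: poisson_measure_def)

lemma poisson_pp_distributionD:
  assumes "poisson_pp_distribution S lam P"
  shows "prob_space P" "sets P = sets (point_pattern_algebra S)" "space P = point_patterns S"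
    and "B \<in> sets S \<Longrightarrow> (\<lambda>\<eta>. emeasure \<eta> B) \<in> borel_measurable P"
    and "B \<in> sets S \<Longrightarrow> distr P borel (\<lambda>\<eta>. emeasure \<eta> B) = poisson_measure (emeasure lam B)"
    and "1 \<le> n \<Longrightarrow> (\<And>i. C i \<in> sets S) \<Longrightarrow> disjoint_family_on C {1..n::nat} \<Longrightarrow>
      prob_space.indep_vars P (\<lambda>_. borel) (\<lambda>i \<eta>. emeasure \<eta> (C i)) {1..n}"
proof -
  note d = assms[unfolded poisson_pp_distribution_def]
  show "prob_space P" using d by blast
  show s: "sets P = sets (point_pattern_algebra S)" using d by blast
  show "space P = point_patterns S"
    using sets_eq_imp_space_eq[OF s] by (simp add: space_point_pattern_algebra)
  show "(\<lambda>\<eta>. emeasure \<eta> B) \<in> borel_measurable P" if "B \<in> sets S"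
    using measurable_emeasure_point_pattern_algebra[OF that] measurable_cong_sets[OF s refl] by blast
  show "distr P borel (\<lambda>\<eta>. emeasure \<eta> B) = poisson_measure (emeasure lam B)" if "B \<in> sets S"
    using d that by blast
  show "prob_space.indep_vars P (\<lambda>_. borel) (\<lambda>i \<eta>. emeasure \<eta> (C i)) {1..n}"
    if "1 \<le> n" "\<And>i. C i \<in> sets S" "disjoint_family_on C {1..n::nat}"
    using d that by blast
qed

lemma poisson_pp_distribution_void:
  assumes "poisson_pp_distribution S lam P" "D \<in> sets S"
  shows "{\<eta>\<in>point_patterns S. emeasure \<eta> D \<noteq> 0} \<in> sets P"
    and "emeasure P {\<eta>\<in>point_patterns S. emeasure \<eta> D \<noteq> 0} = emeasure (poisson_measure (emeasure lam D)) (- {0})"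
proof -
  note d = poisson_pp_distributionD[OF assms(1)]
  note [measurable] = d(4)[OF assms(2)]
  have "{\<eta>\<in>space P. emeasure \<eta> D \<noteq> 0} \<in> sets P" by measurable
  then show "{\<eta>\<in>point_patterns S. emeasure \<eta> D \<noteq> 0} \<in> sets P" by (simp add: d(3))
  have "emeasure (distr P borel (\<lambda>\<eta>. emeasure \<eta> D)) (- {0}) = emeasure P ((\<lambda>\<eta>. emeasure \<eta> D) -` (- {0}) \<inter> space P)"
    by (rule emeasure_distr) auto
  also have "(\<lambda>\<eta>. emeasure \<eta> D) -` (- {0}) \<inter> space P = {\<eta>\<in>point_patterns S. emeasure \<eta> D \<noteq> 0}"
    by (auto simp: d(3))
  finally show "emeasure P {\<eta>\<in>point_patterns S. emeasure \<eta> D \<noteq> 0} = emeasure (poisson_measure (emeasure lam D)) (- {0})"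
    by (simp add: d(5)[OF assms(2)])
qed

lemma poisson_pp_distribution_PiM:
  fixes S lam :: "'a measure"
  assumes "poisson_pp_distribution S lam P" and n: "1 \<le> n" and C: "\<And>i. C i \<in> sets S"
    and "disjoint_family_on C {1..n::nat}"
  shows "distr P (PiM {1..n} (\<lambda>_. borel)) (\<lambda>\<eta>. \<lambda>i\<in>{1..n}. emeasure \<eta> (C i)) =
    PiM {1..n} (\<lambda>i. poisson_measure (emeasure lam (C i)))"
proof -
  note d = poisson_pp_distributionD[OF assms(1)]
  interpret prob_space P by (rule d(1))
  have "{1..n} \<noteq> {}" using n by simp
  from indep_vars_iff_distr_eq_PiM[OF this, of "\<lambda>i \<eta>. emeasure \<eta> (C i)" "\<lambda>_. borel"]
  have "distr P (PiM {1..n} (\<lambda>_. borel)) (\<lambda>\<eta>. \<lambda>i\<in>{1..n}. emeasure \<eta> (C i)) =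
      PiM {1..n} (\<lambda>i. distr P borel (\<lambda>\<eta>. emeasure \<eta> (C i)))"
    using d(6)[OF n C assms(4)] d(4)[OF C] by simp
  then show ?thesis by (simp add: d(5)[OF C])
qed

section \<open>Second-moment bound and its passage to null sets\<close>

text \<open>Each cell contributes a factor \<open>exp (measure W (C i))\<close> for one finite
  measure \<open>W\<close>. Additivity of \<open>W\<close> bounds the product by the exponential of
  its total mass, whatever the partition.\<close>

lemma poisson_cylinder_bound:
  fixes f :: "'a \<Rightarrow> real"
  assumes mu: "sets mu = sets S"
    and f [measurable]: "f \<in> borel_measurable mu" and nn: "\<And>x. 0 \<le> f x"
    and lam: "lam = density mu (\<lambda>x. ennreal (f x))"
    and P: "poisson_pp_distribution S lam P" and Q: "poisson_pp_distribution S mu Q"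
    and D: "D \<in> sets S" "emeasure lam D < \<infinity>" "emeasure mu D < \<infinity>"
    and \<kappa>: "(\<integral>\<^sup>+ x. ennreal ((f x - 1)\<^sup>2) * indicator (- D) x \<partial>mu) < \<infinity>"
  obtains K where "0 \<le> K" "\<And>\<B> A. finite \<B> \<Longrightarrow> \<B> \<subseteq> sets S \<Longrightarrow> A \<in> cylinders S \<B> \<Longrightarrow>
    (measure P (A \<inter> {\<eta>\<in>point_patterns S. emeasure \<eta> D = 0}))\<^sup>2 \<le> K * measure Q A"
proof -
  note dP = poisson_pp_distributionD[OF P] and dQ = poisson_pp_distributionD[OF Q]
  interpret P: prob_space P by (rule dP(1))
  interpret Q: prob_space Q by (rule dQ(1))
  have [measurable]: "D \<in> sets mu" using D mu by simp
  \<comment> \<open>Off \<open>D\<close> the weight reproduces the exponent \<open>\<kappa>\<close>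
    of \<open>poisson_measure_density_set\<close>, on \<open>D\<close> the exponent \<open>m\<close>
    of \<open>poisson_void_density\<close>.\<close>
  define w where "w x = ennreal ((f x - 1)\<^sup>2) * indicator (- D) x + indicator D x" for x
  have [measurable]: "w \<in> borel_measurable mu" unfolding w_def by measurable
  define W where "W = density mu w"
  interpret W: finite_measure W
  proof
    have "emeasure W (space W) = (\<integral>\<^sup>+ x. w x \<partial>mu)"
      unfolding W_def by (subst emeasure_density) (auto intro!: nn_integral_cong)
    also have "\<dots> = (\<integral>\<^sup>+ x. ennreal ((f x - 1)\<^sup>2) * indicator (- D) x \<partial>mu) + emeasure mu D"
      unfolding w_def by (subst nn_integral_add) auto
    finally show "emeasure W (space W) \<noteq> \<infinity>" using \<kappa> D by (simp add: less_top)
  qed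
  have sW: "sets W = sets S" by (simp add: W_def mu)
  have bound: "(measure P (A \<inter> {\<eta>\<in>point_patterns S. emeasure \<eta> D = 0}))\<^sup>2 \<le>
      exp (measure W (space W)) * measure Q A"
    if \<B>: "finite \<B>" "\<B> \<subseteq> sets S" "A \<in> cylinders S \<B>" for \<B> A
  proof -
    have "A \<in> cylinders S (insert D \<B>)" using \<B>(3) cylinders_mono[of \<B> "insert D \<B>"] by blast
    then obtain n C H where n: "1 \<le> n" and C: "\<And>i. C i \<in> sets S" and dis: "disjoint_family_on C {1..n::nat}"
      and CD: "\<And>i. C i \<subseteq> D \<or> C i \<inter> D = {}" and H: "H \<in> sets (PiM {1..n} (\<lambda>_. borel))"
      and A: "A = {\<eta>\<in>point_patterns S. (\<lambda>i\<in>{1..n}. emeasure \<eta> (C i)) \<in> H}"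
      by (rule cylinder_cells) (use \<B> D in auto)
    define p where "p i = poisson_measure (emeasure lam (C i))" for i
    define q where "q i = poisson_measure (emeasure mu (C i))" for i
    \<comment> \<open>The truncation: cells inside \<open>D\<close> are required to be empty, all
      others are left free.\<close>
    define e :: "nat \<Rightarrow> ennreal \<Rightarrow> ennreal" where "e i = (if C i \<subseteq> D then indicator {0} else (\<lambda>_. 1))" for i
    have [measurable]: "C i \<in> sets mu" for i using C mu by simp
    have [measurable]: "e i \<in> borel_measurable borel" for i by (simp add: e_def)
    have "\<exists>z. z \<in> borel_measurable borel \<and> density (p i) (e i) = density (q i) z \<and>
        (\<integral>\<^sup>+ x. (z x)\<^sup>2 \<partial>q i) \<le> ennreal (exp (measure W (C i)))" for i
    proof (cases "C i \<subseteq> D")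
      case True
      have "emeasure lam (C i) < \<infinity>" "emeasure mu (C i) < \<infinity>"
        using emeasure_mono[OF True, of lam] emeasure_mono[OF True, of mu] D mu lam by (auto simp: less_top[symmetric] top_unique)
      then obtain l m where l: "emeasure lam (C i) = ennreal l" "0 \<le> l" and m: "emeasure mu (C i) = ennreal m" "0 \<le> m"
        by (metis ennreal_cases less_irrefl infinity_ennreal_def)
      have "emeasure W (C i) = (\<integral>\<^sup>+ x. w x * indicator (C i) x \<partial>mu)"
        unfolding W_def by (rule emeasure_density) auto
      also have "\<dots> = (\<integral>\<^sup>+ x. indicator (C i) x \<partial>mu)"
        using True by (intro nn_integral_cong) (auto simp: w_def indicator_def)
      finally have "emeasure W (C i) = emeasure mu (C i)" by simp
      then have "measure W (C i) = m" using m by (simp add: measure_def)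
      then show ?thesis
        using poisson_void_density[OF l(2) m(2)] True
        by (intro exI[of _ "\<lambda>x. ennreal (exp (m - l)) * indicator {0} x"]) (simp add: p_def q_def e_def l m)
    next
      case False
      then have dj: "C i \<inter> D = {}" using CD by blast
      have "emeasure W (C i) = (\<integral>\<^sup>+ x. ennreal ((f x - 1)\<^sup>2) * indicator (C i) x \<partial>mu)"
        unfolding W_def using dj by (subst emeasure_density) (auto simp: w_def indicator_def intro!: nn_integral_cong)
      then have "(\<integral>\<^sup>+ x. ennreal ((f x - 1)\<^sup>2) * indicator (C i) x \<partial>mu) = ennreal (measure W (C i))"
        by (simp add: W.emeasure_eq_measure)
      from poisson_measure_density_set[OF f nn lam _ this] obtain z where
        "z \<in> borel_measurable borel"
        "poisson_measure (emeasure lam (C i)) = density (poisson_measure (emeasure mu (C i))) z"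
        "(\<integral>\<^sup>+ x. (z x)\<^sup>2 \<partial>poisson_measure (emeasure mu (C i))) \<le> ennreal (exp (measure W (C i)))"
        by auto
      then show ?thesis using False by (auto simp: p_def q_def e_def density_1)
    qed
    then obtain z where z: "\<And>i. z i \<in> borel_measurable borel" "\<And>i. density (p i) (e i) = density (q i) (z i)"
      "\<And>i. (\<integral>\<^sup>+ x. (z i x)\<^sup>2 \<partial>q i) \<le> ennreal (exp (measure W (C i)))" by metis
    let ?v = "\<lambda>\<eta> :: 'a measure. \<lambda>i\<in>{1..n}. emeasure \<eta> (C i)"
    have [measurable]: "?v \<in> measurable P (PiM {1..n} (\<lambda>_. borel))" "?v \<in> measurable Q (PiM {1..n} (\<lambda>_. borel))"
      by (auto intro!: measurable_restrict dP(4) dQ(4) C)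
    have pP: "distr P (PiM {1..n} (\<lambda>_. borel)) ?v = PiM {1..n} p"
      unfolding p_def by (rule poisson_pp_distribution_PiM[OF P n C dis])
    have qQ: "distr Q (PiM {1..n} (\<lambda>_. borel)) ?v = PiM {1..n} q"
      unfolding q_def by (rule poisson_pp_distribution_PiM[OF Q n C dis])
    let ?E = "{\<eta>\<in>point_patterns S. emeasure \<eta> D = 0}"
    note [measurable] = H dP(4)[OF D(1)]
    have [measurable]: "(\<lambda>x. \<Prod>i\<in>{1..n}. e i (x i)) \<in> borel_measurable (PiM {1..n} (\<lambda>_. borel))"
      by (intro borel_measurable_prod_ennreal measurable_compose[OF measurable_component_singleton]) auto
    have AP: "A = ?v -` H \<inter> space P" by (auto simp: A dP(3))
    have AE: "A \<inter> ?E \<in> sets P"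
    proof -
      have "A \<in> sets P" unfolding AP by measurable
      moreover have "{\<eta>\<in>space P. emeasure \<eta> D = 0} \<in> sets P" by measurable
      ultimately show ?thesis by (auto simp: dP(3))
    qed
    have "emeasure P (A \<inter> ?E) = (\<integral>\<^sup>+ \<eta>. indicator (A \<inter> ?E) \<eta> \<partial>P)" using AE by simp
    \<comment> \<open>If \<open>D\<close> carries no point, neither does any cell inside it, so the
      product of truncations is \<open>1\<close> there.\<close>
    also have "\<dots> \<le> (\<integral>\<^sup>+ \<eta>. (\<Prod>i\<in>{1..n}. e i (?v \<eta> i)) * indicator H (?v \<eta>) \<partial>P)"
    proof (rule nn_integral_mono)
      fix \<eta> assume "\<eta> \<in> space P"
      show "indicator (A \<inter> ?E) \<eta> \<le> (\<Prod>i\<in>{1..n}. e i (?v \<eta> i)) * indicator H (?v \<eta>)"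
      proof (cases "\<eta> \<in> A \<inter> ?E")
        case True
        then have "emeasure \<eta> (C i) = 0" if "C i \<subseteq> D" for i
          using emeasure_mono[OF that, of \<eta>] D by (auto simp: point_patterns_def)
        then have "e i (?v \<eta> i) = 1" if "i \<in> {1..n}" for i
          using that by (simp add: e_def)
        then show ?thesis using True by (simp add: A)
      qed simp
    qed
    also have "\<dots> = (\<integral>\<^sup>+ x. (\<Prod>i\<in>{1..n}. e i (x i)) * indicator H x \<partial>PiM {1..n} p)"
      unfolding pP[symmetric] by (rule nn_integral_distr[symmetric]) measurable
    finally have "(emeasure P (A \<inter> ?E))\<^sup>2 \<le> (\<integral>\<^sup>+ x. (\<Prod>i\<in>{1..n}. e i (x i)) * indicator H x \<partial>PiM {1..n} p)\<^sup>2"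
      by (rule power_mono) simp
    also have "\<dots> \<le> (\<Prod>i\<in>{1..n}. \<integral>\<^sup>+ x. (z i x)\<^sup>2 \<partial>q i) * emeasure (PiM {1..n} q) H"
    proof (rule PiM_density_square_le)
      show "H \<in> sets (PiM {1..n} q)" unfolding qQ[symmetric] using H by simp
      show "e i x \<le> 1" for i x by (simp add: e_def indicator_def)
    qed (use z in \<open>auto simp: p_def q_def prob_space_poisson_measure\<close>)
    also have "emeasure (PiM {1..n} q) H = emeasure Q A"
    proof -
      have "emeasure (PiM {1..n} q) H = emeasure Q (?v -` H \<inter> space Q)"
        unfolding qQ[symmetric] by (rule emeasure_distr) measurable
      also have "?v -` H \<inter> space Q = A" by (auto simp: A dQ(3))
      finally show ?thesis .
    qed
    also have "(\<Prod>i\<in>{1..n}. \<integral>\<^sup>+ x. (z i x)\<^sup>2 \<partial>q i) \<le> (\<Prod>i\<in>{1..n}. ennreal (exp (measure W (C i))))"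
      using z(3) by (intro prod_mono_ennreal)
    also have "\<dots> = ennreal (exp (\<Sum>i\<in>{1..n}. measure W (C i)))"
      by (simp add: prod_ennreal exp_sum)
    also have "(\<Sum>i\<in>{1..n}. measure W (C i)) = measure W (\<Union>i\<in>{1..n}. C i)"
      using C dis by (intro W.finite_measure_finite_Union[symmetric]) (auto simp: sW)
    also have "ennreal (exp (measure W (\<Union>i\<in>{1..n}. C i))) \<le> ennreal (exp (measure W (space W)))"
      using W.bounded_measure by (intro ennreal_leI) simp
    finally have "(emeasure P (A \<inter> ?E))\<^sup>2 \<le> ennreal (exp (measure W (space W))) * emeasure Q A"
      by (simp add: mult_right_mono)
    then show ?thesis
      by (simp add: P.emeasure_eq_measure Q.emeasure_eq_measure ennreal_power ennreal_mult[symmetric])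
  qed
  show ?thesis by (rule that[OF _ bound]) auto
qed

text \<open>On the event \<open>E\<close> that \<open>D\<close> is empty, the cylinder bound forces
  \<open>N\<close> to be \<open>P\<close>-null; the rest of \<open>N\<close> lies in the event that
  \<open>D\<close> has a point, of probability at most \<open>lam D\<close>.\<close>

lemma poisson_null_set_le:
  fixes f :: "'a \<Rightarrow> real"
  assumes mu: "sets mu = sets S"
    and f [measurable]: "f \<in> borel_measurable mu" and nn: "\<And>x. 0 \<le> f x"
    and lam: "lam = density mu (\<lambda>x. ennreal (f x))"
    and P: "poisson_pp_distribution S lam P" and Q: "poisson_pp_distribution S mu Q"
    and D: "D \<in> sets S" "emeasure lam D < \<infinity>" "emeasure mu D < \<infinity>"
    and \<kappa>: "(\<integral>\<^sup>+ x. ennreal ((f x - 1)\<^sup>2) * indicator (- D) x \<partial>mu) < \<infinity>"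
    and N: "N \<in> null_sets Q"
  shows "emeasure P N \<le> emeasure lam D"
proof -
  note dP = poisson_pp_distributionD[OF P] and dQ = poisson_pp_distributionD[OF Q]
  interpret P: prob_space P by (rule dP(1))
  interpret Q: prob_space Q by (rule dQ(1))
  obtain K where K: "0 \<le> K" "\<And>\<B> A. finite \<B> \<Longrightarrow> \<B> \<subseteq> sets S \<Longrightarrow> A \<in> cylinders S \<B> \<Longrightarrow>
    (measure P (A \<inter> {\<eta>\<in>point_patterns S. emeasure \<eta> D = 0}))\<^sup>2 \<le> K * measure Q A"
    using poisson_cylinder_bound[OF mu f nn lam P Q D \<kappa>] by blast
  let ?\<A> = "\<Union>\<B>\<in>{\<B>. finite \<B> \<and> \<B> \<subseteq> sets S}. cylinders S \<B>"
  define E where "E = {\<eta>\<in>point_patterns S. emeasure \<eta> D = 0}"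
  have PQ: "sets P = sets Q" using dP(2) dQ(2) by simp
  have NP: "N \<in> sets P" "N \<in> sets Q" using N PQ by auto
  have E: "E \<in> sets P" "space P - E \<in> sets P"
  proof -
    have "{\<eta>\<in>space P. emeasure \<eta> D = 0} \<in> sets P" using dP(4)[OF D(1)] by measurable
    then show "E \<in> sets P" by (simp add: E_def dP(3))
    then show "space P - E \<in> sets P" by simp
  qed
  \<comment> \<open>Approximating in the sum of both laws yields one cylinder that is close to
    \<open>N\<close> under \<open>P\<close> and \<open>Q\<close> at once.\<close>
  let ?R = "plus_measure P Q"
  have R: "emeasure ?R X = ennreal (measure P X + measure Q X)" if "X \<in> sets P" for X
    using that by (simp add: emeasure_plus_measure PQ P.emeasure_eq_measure Q.emeasure_eq_measure)
  interpret R: finite_measure ?R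
    by standard (simp add: R)
  have gen: "sets P = sigma_sets (point_patterns S) ?\<A>"
    unfolding dP(2) by (rule sets_point_pattern_algebra_cylinders)
  have le: "measure P (N \<inter> E) \<le> sqrt (K * e) + e" if e: "0 < e" for e
  proof -
    obtain B where B: "B \<in> ?\<A>" "measure ?R (sym_diff N B) < e"
      using R.algebra_approximation[of ?\<A> N e] algebra_cylinders[of S] gen NP e by (auto simp: dP(3))
    have BP: "B \<in> sets P" unfolding gen using B(1) by (rule sigma_sets.Basic)
    have BQ: "B \<in> sets Q" using BP PQ by simp
    have s: "sym_diff N B \<in> sets P" using BP NP by auto
    have "measure P (sym_diff N B) + measure Q (sym_diff N B) < e"
      using B(2) unfolding measure_def[of ?R] R[OF s] by (simp del: ennreal_plus)
    then have pq: "measure P (sym_diff N B) \<le> e" "measure Q (sym_diff N B) \<le> e"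
      using measure_nonneg[of P "sym_diff N B"] measure_nonneg[of Q "sym_diff N B"] by linarith+
    \<comment> \<open>As \<open>N\<close> is \<open>Q\<close>-null, the approximating cylinder has
      \<open>Q\<close>-mass at most \<open>e\<close>, and its part in \<open>E\<close> has
      \<open>P\<close>-mass at most \<open>sqrt (K * e)\<close>.\<close>
    have "measure Q B \<le> measure Q (N \<union> sym_diff N B)"
      using NP BQ by (intro Q.finite_measure_mono) auto
    also have "\<dots> \<le> measure Q N + measure Q (sym_diff N B)"
      using NP BQ by (intro measure_Un_le) auto
    also have "\<dots> \<le> e" using N pq by (simp add: measure_eq_0_null_sets)
    finally have "K * measure Q B \<le> K * e" using K(1) by (rule mult_left_mono)
    moreover have "(measure P (B \<inter> E))\<^sup>2 \<le> K * measure Q B"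
      using B(1) K(2) unfolding E_def by auto
    ultimately have "measure P (B \<inter> E) \<le> sqrt (K * e)"
      by (intro real_le_rsqrt) simp
    moreover have "measure P (N \<inter> E) \<le> measure P ((B \<inter> E) \<union> sym_diff N B)"
      using NP BP E by (intro P.finite_measure_mono) auto
    moreover have "\<dots> \<le> measure P (B \<inter> E) + measure P (sym_diff N B)"
      using NP BP E by (intro measure_Un_le) auto
    ultimately show ?thesis using pq by linarith
  qed
  have "((\<lambda>e. sqrt (K * e) + e) \<longlongrightarrow> sqrt (K * 0) + 0) (at_right 0)"
    by (intro tendsto_intros)
  then have "measure P (N \<inter> E) \<le> sqrt (K * 0) + 0"
    by (rule tendsto_lowerbound) (auto intro: eventually_mono[OF eventually_at_right_less] le)
  then have "emeasure P (N \<inter> E) = 0"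
    by (simp add: P.emeasure_eq_measure measure_le_0_iff)
  have "emeasure P N \<le> emeasure P ((N \<inter> E) \<union> (space P - E))"
    using NP E sets.sets_into_space[OF NP(1)] by (intro emeasure_mono) auto
  also have "\<dots> \<le> emeasure P (N \<inter> E) + emeasure P (space P - E)"
    using NP E by (intro emeasure_subadditive) auto
  also have "\<dots> = emeasure P (space P - E)" by (simp add: \<open>emeasure P (N \<inter> E) = 0\<close>)
  also have "space P - E = {\<eta>\<in>point_patterns S. emeasure \<eta> D \<noteq> 0}" by (auto simp: E_def dP(3))
  also have "emeasure P \<dots> \<le> emeasure lam D"
    unfolding poisson_pp_distribution_void(2)[OF P D(1)] by (rule emeasure_poisson_measure_nonzero_le)
  finally show ?thesis .
qed

lemma poisson_absolutely_continuous:
  fixes f :: "'a \<Rightarrow> real"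
  assumes mu: "sets mu = sets S"
    and f [measurable]: "f \<in> borel_measurable mu" and nn: "\<And>x. 0 \<le> f x"
    and lam: "lam = density mu (\<lambda>x. ennreal (f x))"
    and P: "poisson_pp_distribution S lam P" and Q: "poisson_pp_distribution S mu Q"
    and fin: "(\<integral>\<^sup>+ x. ennreal ((sqrt (f x) - 1)\<^sup>2) \<partial>mu) < \<infinity>"
  shows "absolutely_continuous Q P"
proof -
  have PQ: "sets P = sets Q"
    using poisson_pp_distributionD(2)[OF P] poisson_pp_distributionD(2)[OF Q] by simp
  \<comment> \<open>Thresholds from \<open>4\<close> on give \<open>sqrt (f x) \<ge> 2\<close>,
    hence \<open>f x \<le> 4 * (sqrt (f x) - 1)\<^sup>2\<close> on \<open>D k\<close> and a finite
    \<open>lam\<close>-mass; since \<open>f > 1\<close> there, the \<open>mu\<close>-mass is finite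
    too.\<close>
  define D where "D k = {x\<in>space mu. real k + 4 < f x}" for k :: nat
  have D [measurable]: "D k \<in> sets mu" for k unfolding D_def by measurable
  have Dlam: "emeasure lam (D k) < \<infinity>" for k
  proof -
    have "emeasure lam (D k) = (\<integral>\<^sup>+ x. ennreal (f x) * indicator (D k) x \<partial>mu)"
      unfolding lam by (rule emeasure_density) auto
    also have "\<dots> \<le> (\<integral>\<^sup>+ x. 4 * ennreal ((sqrt (f x) - 1)\<^sup>2) \<partial>mu)"
    proof (rule nn_integral_mono)
      fix x
      show "ennreal (f x) * indicator (D k) x \<le> 4 * ennreal ((sqrt (f x) - 1)\<^sup>2)"
      proof (cases "x \<in> D k")
        case True
        then have "4 \<le> f x" by (auto simp: D_def)
        then have "2 \<le> sqrt (f x)" using real_sqrt_le_mono[of 4 "f x"] by simp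
        then have "(sqrt (f x))\<^sup>2 \<le> (2 * (sqrt (f x) - 1))\<^sup>2" by (intro power_mono) (auto simp: nn)
        then have "f x \<le> 4 * (sqrt (f x) - 1)\<^sup>2" using nn[of x] unfolding power_mult_distrib by simp
        then show ?thesis using True ennreal_leI by (fastforce simp: ennreal_mult)
      qed simp
    qed
    also have "\<dots> < \<infinity>" using fin by (simp add: nn_integral_cmult ennreal_mult_less_top)
    finally show ?thesis .
  qed
  have Dmu: "emeasure mu (D k) < \<infinity>" for k
  proof -
    have "emeasure mu (D k) = (\<integral>\<^sup>+ x. indicator (D k) x \<partial>mu)" by simp
    also have "\<dots> \<le> (\<integral>\<^sup>+ x. ennreal (f x) * indicator (D k) x \<partial>mu)"
      by (intro nn_integral_mono) (auto simp: indicator_def D_def)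
    also have "\<dots> = emeasure lam (D k)"
      unfolding lam by (rule emeasure_density[symmetric]) auto
    finally show ?thesis using Dlam by (rule le_less_trans)
  qed
  have \<kappa>: "(\<integral>\<^sup>+ x. ennreal ((f x - 1)\<^sup>2) * indicator (- D k) x \<partial>mu) < \<infinity>" for k
  proof -
    \<comment> \<open>\<open>f - 1\<close> factors as \<open>(sqrt f + 1) * (sqrt f - 1)\<close>,
      and off \<open>D k\<close> the first factor is bounded.\<close>
    let ?M = "(sqrt (real k + 4) + 1)\<^sup>2"
    have "(\<integral>\<^sup>+ x. ennreal ((f x - 1)\<^sup>2) * indicator (- D k) x \<partial>mu) \<le>
        (\<integral>\<^sup>+ x. ennreal ?M * ennreal ((sqrt (f x) - 1)\<^sup>2) \<partial>mu)"
    proof (rule nn_integral_mono)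
      fix x assume x: "x \<in> space mu"
      show "ennreal ((f x - 1)\<^sup>2) * indicator (- D k) x \<le> ennreal ?M * ennreal ((sqrt (f x) - 1)\<^sup>2)"
      proof (cases "x \<in> D k")
        case False
        then have "f x \<le> real k + 4" using x by (auto simp: D_def)
        then have "(sqrt (f x) + 1)\<^sup>2 \<le> ?M" using nn[of x] by (intro power_mono) auto
        then have "(sqrt (f x) + 1)\<^sup>2 * (sqrt (f x) - 1)\<^sup>2 \<le> ?M * (sqrt (f x) - 1)\<^sup>2"
          by (rule mult_right_mono) simp
        moreover have "(sqrt (f x) + 1) * (sqrt (f x) - 1) = f x - 1"
          using nn[of x] by (simp add: algebra_simps)
        then have "(sqrt (f x) + 1)\<^sup>2 * (sqrt (f x) - 1)\<^sup>2 = (f x - 1)\<^sup>2"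
          by (simp add: power_mult_distrib[symmetric])
        ultimately show ?thesis using False by (simp add: ennreal_mult[symmetric] ennreal_leI)
      qed simp
    qed
    also have "\<dots> < \<infinity>" using fin by (simp add: nn_integral_cmult ennreal_mult_less_top)
    finally show ?thesis .
  qed
  \<comment> \<open>The sets \<open>D k\<close> decrease to the empty set because \<open>f\<close>
    is real-valued, so continuity from above sends the bound on \<open>P N\<close> to
    \<open>0\<close>.\<close>
  have "(\<lambda>k. emeasure lam (D k)) \<longlonglongrightarrow> emeasure lam (\<Inter>k. D k)"
  proof (rule Lim_emeasure_decseq)
    show "range D \<subseteq> sets lam" using D by (auto simp: lam)
    show "decseq D" by (auto simp: decseq_def D_def)
    show "\<And>k. emeasure lam (D k) \<noteq> \<infinity>" using Dlam by (simp add: less_top)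
  qed
  moreover have "(\<Inter>k. D k) = {}"
  proof safe
    fix x assume "x \<in> (\<Inter>k. D k)"
    then have "real k + 4 < f x" for k by (auto simp: D_def)
    moreover obtain k where "f x \<le> real k" using real_arch_simple by blast
    ultimately show "x \<in> {}" by (smt (verit, best))
  qed
  ultimately have lim: "(\<lambda>k. emeasure lam (D k)) \<longlonglongrightarrow> 0" by simp
  show ?thesis
    unfolding absolutely_continuous_def
  proof
    fix N assume N: "N \<in> null_sets Q"
    have "emeasure P N \<le> emeasure lam (D k)" for k
      using D mu by (intro poisson_null_set_le[OF mu f nn lam P Q _ Dlam Dmu \<kappa> N]) simp
    then have "emeasure P N \<le> 0" by (intro tendsto_lowerbound[OF lim]) auto
    then show "N \<in> null_sets P" using N PQ by auto
  qed
qed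

section \<open>Singularity for infinite Hellinger distance\<close>

lemma poisson_pp_nn_integral_powers:
  assumes P: "poisson_pp_distribution S lam P"
    and C: "\<And>i. C i \<in> sets S" "disjoint_family_on C {1..n::nat}" and n: "1 \<le> n"
    and l: "\<And>i. emeasure lam (C i) = ennreal (l i)" "\<And>i. 0 \<le> l i" and c: "\<And>i. 0 \<le> c i"
  shows "(\<integral>\<^sup>+ \<eta>. ennreal (\<Prod>i\<in>{1..n}. c i ^ count_of (emeasure \<eta> (C i))) \<partial>P) =
    ennreal (exp (\<Sum>i\<in>{1..n}. l i * (c i - 1)))"
proof -
  note d = poisson_pp_distributionD[OF P]
  interpret prob_space P by (rule d(1))
  have "indep_vars (\<lambda>_. borel) (\<lambda>i \<eta>. ennreal (c i ^ count_of (emeasure \<eta> (C i)))) {1..n}"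
    by (rule indep_vars_compose2[OF d(6)[OF n C]]) measurable
  then have "(\<integral>\<^sup>+ \<eta>. (\<Prod>i\<in>{1..n}. ennreal (c i ^ count_of (emeasure \<eta> (C i)))) \<partial>P) =
      (\<Prod>i\<in>{1..n}. \<integral>\<^sup>+ \<eta>. ennreal (c i ^ count_of (emeasure \<eta> (C i))) \<partial>P)"
    by (intro indep_vars_nn_integral) auto
  also have "\<dots> = (\<Prod>i\<in>{1..n}. ennreal (exp (l i * (c i - 1))))"
  proof (rule prod.cong[OF refl])
    fix i
    have "(\<integral>\<^sup>+ \<eta>. ennreal (c i ^ count_of (emeasure \<eta> (C i))) \<partial>P) =
        (\<integral>\<^sup>+ x. ennreal (c i ^ count_of x) \<partial>distr P borel (\<lambda>\<eta>. emeasure \<eta> (C i)))"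
      by (subst nn_integral_distr) (auto intro: d(4)[OF C(1)])
    then show "(\<integral>\<^sup>+ \<eta>. ennreal (c i ^ count_of (emeasure \<eta> (C i))) \<partial>P) = ennreal (exp (l i * (c i - 1)))"
      using l c by (simp add: d(5)[OF C(1)] nn_integral_power_poisson_measure)
  qed
  finally show ?thesis using c by (simp add: prod_ennreal exp_sum)
qed

text \<open>Markov's inequality at an exponential threshold, the form used for the Chernoff
  bounds.\<close>

lemma emeasure_ge_le_nn_integral:
  assumes X [measurable]: "X \<in> borel_measurable M"
  shows "emeasure M {x\<in>space M. exp t \<le> X x} \<le> ennreal (exp (- t)) * (\<integral>\<^sup>+ x. ennreal (X x) \<partial>M)"
proof -
  have "emeasure M {x\<in>space M. 1 \<le> ennreal (exp (- t)) * ennreal (X x)} \<le>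
      ennreal (exp (- t)) * (\<integral>\<^sup>+ x. ennreal (X x) * indicator (space M) x \<partial>M)"
    by (rule nn_integral_Markov_inequality) auto
  also have "(\<integral>\<^sup>+ x. ennreal (X x) * indicator (space M) x \<partial>M) = (\<integral>\<^sup>+ x. ennreal (X x) \<partial>M)"
    by (intro nn_integral_cong) simp
  also have "{x\<in>space M. 1 \<le> ennreal (exp (- t)) * ennreal (X x)} = {x\<in>space M. exp t \<le> X x}"
  proof -
    have "1 \<le> ennreal (exp (- t)) * ennreal y \<longleftrightarrow> exp t \<le> y" for y
    proof -
      have "ennreal (exp (- t)) * ennreal y = ennreal (exp (- t) * y)" by (simp add: ennreal_mult')
      then show ?thesis by (simp add: exp_minus field_simps)
    qed
    then show ?thesis by simp
  qed
  finally show ?thesis .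
qed

text \<open>The test statistic \<open>X n\<close> separates the laws: under \<open>Q\<close> it
  rarely exceeds a threshold, under \<open>P\<close> it rarely falls below it, with both errors
  vanishing along a subsequence.\<close>

lemma poisson_not_absolutely_continuous:
  assumes P: "poisson_pp_distribution S lam P" and Q: "poisson_pp_distribution S mu Q"
    and C: "\<And>i. C i \<in> sets S" "\<And>n. disjoint_family_on C {1..n::nat}"
    and l: "\<And>i. emeasure lam (C i) = ennreal (l i)" "\<And>i. 0 \<le> l i"
    and m: "\<And>i. emeasure mu (C i) = ennreal (m i)" "\<And>i. 0 \<le> m i"
    and c: "\<And>i. 0 < c i" and le: "\<And>i. m i * (c i - 1) + l i * (1 / c i - 1) \<le> - a i"
    and unb: "\<And>b. \<exists>n\<ge>1. b \<le> (\<Sum>i\<in>{1..n}. a i)"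
  shows "\<not> absolutely_continuous Q P"
proof
  assume ac: "absolutely_continuous Q P"
  note dP = poisson_pp_distributionD[OF P] and dQ = poisson_pp_distributionD[OF Q]
  interpret P: prob_space P by (rule dP(1))
  interpret Q: prob_space Q by (rule dQ(1))
  define X where "X n \<eta> = (\<Prod>i\<in>{1..n}. c i ^ count_of (emeasure \<eta> (C i)))" for n and \<eta> :: "'a measure"
  define Y where "Y n \<eta> = (\<Prod>i\<in>{1..n}. (1 / c i) ^ count_of (emeasure \<eta> (C i)))" for n and \<eta> :: "'a measure"
  have XY: "X n \<eta> * Y n \<eta> = 1" for n \<eta>
    using c by (simp add: X_def Y_def prod.distrib[symmetric] power_mult_distrib[symmetric] less_imp_neq[symmetric])
  have X0: "0 < X n \<eta>" for n \<eta> using c by (simp add: X_def prod_pos)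
  define \<alpha> where "\<alpha> n = (\<Sum>i\<in>{1..n}. m i * (c i - 1))" for n
  define \<beta> where "\<beta> n = (\<Sum>i\<in>{1..n}. l i * (1 / c i - 1))" for n
  \<comment> \<open>\<open>\<alpha> n\<close> and \<open>\<beta> n\<close> are the logarithms of the
    means of \<open>X n\<close> under \<open>Q\<close> and of its inverse \<open>Y n\<close> under
    \<open>P\<close>. This threshold balances the two bounds: both become
    \<open>exp ((\<alpha> n + \<beta> n) / 2)\<close>.\<close>
  define T where "T n = {\<eta>\<in>point_patterns S. exp ((\<alpha> n - \<beta> n) / 2) \<le> X n \<eta>}" for n
  have sum: "\<alpha> n + \<beta> n \<le> - (\<Sum>i\<in>{1..n}. a i)" for n
    unfolding \<alpha>_def \<beta>_def sum.distrib[symmetric] sum_negf[symmetric] using le by (intro sum_mono) auto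
  note [measurable] = dP(4)[OF C(1)] dQ(4)[OF C(1)]
  have [measurable]: "X n \<in> borel_measurable P" "X n \<in> borel_measurable Q" "Y n \<in> borel_measurable P" for n
    unfolding X_def Y_def by measurable
  have TQ [measurable]: "T n \<in> sets Q" for n
  proof -
    have "{\<eta>\<in>space Q. exp ((\<alpha> n - \<beta> n) / 2) \<le> X n \<eta>} \<in> sets Q" by measurable
    then show ?thesis by (simp add: T_def dQ(3))
  qed
  have PQ: "sets P = sets Q" using dP(2) dQ(2) by simp
  have TP [measurable]: "T n \<in> sets P" for n using TQ PQ by simp
  have Qle: "measure Q (T n) \<le> exp ((\<alpha> n + \<beta> n) / 2)" if "1 \<le> n" for n
  proof -
    have "emeasure Q (T n) \<le> ennreal (exp (- ((\<alpha> n - \<beta> n) / 2))) * (\<integral>\<^sup>+ \<eta>. ennreal (X n \<eta>) \<partial>Q)"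
      using emeasure_ge_le_nn_integral[of "X n" Q "(\<alpha> n - \<beta> n) / 2"] by (simp add: T_def dQ(3))
    also have "(\<integral>\<^sup>+ \<eta>. ennreal (X n \<eta>) \<partial>Q) = ennreal (exp (\<alpha> n))"
      unfolding X_def \<alpha>_def using poisson_pp_nn_integral_powers[OF Q C that m] c less_imp_le by blast
    also have "ennreal (exp (- ((\<alpha> n - \<beta> n) / 2))) * ennreal (exp (\<alpha> n)) = ennreal (exp ((\<alpha> n + \<beta> n) / 2))"
      by (simp add: ennreal_mult[symmetric] exp_add[symmetric] field_simps)
    finally show ?thesis by (simp add: Q.emeasure_eq_measure)
  qed
  have Ple: "measure P (space P - T n) \<le> exp ((\<alpha> n + \<beta> n) / 2)" if "1 \<le> n" for n
  proof -
    have Y: "exp (- ((\<alpha> n - \<beta> n) / 2)) \<le> Y n \<eta>" if "X n \<eta> < exp ((\<alpha> n - \<beta> n) / 2)" for \<eta>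
    proof -
      have "Y n \<eta> = inverse (X n \<eta>)"
        using XY[of n \<eta>] X0[of n \<eta>] by (simp add: field_simps)
      moreover have "inverse (exp ((\<alpha> n - \<beta> n) / 2)) \<le> inverse (X n \<eta>)"
        using that X0 by (intro le_imp_inverse_le) auto
      ultimately show ?thesis by (simp add: exp_minus)
    qed
    have "space P - T n \<subseteq> {\<eta>\<in>space P. exp (- ((\<alpha> n - \<beta> n) / 2)) \<le> Y n \<eta>}"
      using Y unfolding T_def dP(3) by fastforce
    then have "emeasure P (space P - T n) \<le> emeasure P {\<eta>\<in>space P. exp (- ((\<alpha> n - \<beta> n) / 2)) \<le> Y n \<eta>}"
      by (rule emeasure_mono) measurable
    also have "\<dots> \<le> ennreal (exp ((\<alpha> n - \<beta> n) / 2)) * (\<integral>\<^sup>+ \<eta>. ennreal (Y n \<eta>) \<partial>P)"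
      using emeasure_ge_le_nn_integral[of "Y n" P "- ((\<alpha> n - \<beta> n) / 2)"] by simp
    also have "(\<integral>\<^sup>+ \<eta>. ennreal (Y n \<eta>) \<partial>P) = ennreal (exp (\<beta> n))"
      unfolding Y_def \<beta>_def using poisson_pp_nn_integral_powers[OF P C that l, of "\<lambda>i. 1 / c i"] c
      by (simp add: less_imp_le)
    also have "ennreal (exp ((\<alpha> n - \<beta> n) / 2)) * ennreal (exp (\<beta> n)) = ennreal (exp ((\<alpha> n + \<beta> n) / 2))"
      by (simp add: ennreal_mult[symmetric] exp_add[symmetric] field_simps)
    finally show ?thesis by (simp add: P.emeasure_eq_measure)
  qed
  have "\<exists>n\<ge>1. exp ((\<alpha> n + \<beta> n) / 2) \<le> (1 / 2) ^ k" for k :: nat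
  proof -
    \<comment> \<open>The factor \<open>2\<close> compensates the halving of the exponent, so the
      errors are at most \<open>(1 / 2) ^ k\<close> and hence summable.\<close>
    obtain n where n: "1 \<le> n" "2 * real k * ln 2 \<le> (\<Sum>i\<in>{1..n}. a i)" using unb by blast
    then have "(\<alpha> n + \<beta> n) / 2 \<le> real k * - ln 2" using sum[of n] by simp
    then have "exp ((\<alpha> n + \<beta> n) / 2) \<le> exp (real k * - ln 2)" by simp
    also have "\<dots> = (1 / 2) ^ k" by (simp add: exp_of_nat_mult exp_minus inverse_eq_divide power_one_over)
    finally show ?thesis using n by blast
  qed
  then obtain r where r: "\<And>k. 1 \<le> r k" "\<And>k. exp ((\<alpha> (r k) + \<beta> (r k)) / 2) \<le> (1 / 2) ^ k" by metis
  have geo: "summable (\<lambda>k. (1 / 2 :: real) ^ k)" by (simp add: summable_geometric)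
  \<comment> \<open>By Borel--Cantelli, \<open>Q\<close>-almost every pattern eventually avoids
    \<open>T (r k)\<close>. Absolute continuity carries this over to \<open>P\<close>, under which
    almost every pattern eventually lies in \<open>T (r k)\<close>.\<close>
  have "AE \<eta> in Q. eventually (\<lambda>k. \<eta> \<in> space Q - T (r k)) sequentially"
  proof (rule borel_cantelli_AE1)
    show "summable (\<lambda>k. measure Q (T (r k)))"
      by (rule summable_comparison_test'[OF geo, of 0]) (use order_trans[OF Qle[OF r(1)] r(2)] in simp)
  qed (auto simp: Q.emeasure_eq_measure)
  then have "AE \<eta> in P. eventually (\<lambda>k. \<eta> \<in> space Q - T (r k)) sequentially"
    by (rule absolutely_continuous_AE[OF PQ ac])
  moreover have "AE \<eta> in P. eventually (\<lambda>k. \<eta> \<in> space P - (space P - T (r k))) sequentially"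
  proof (rule borel_cantelli_AE1)
    show "summable (\<lambda>k. measure P (space P - T (r k)))"
      by (rule summable_comparison_test'[OF geo, of 0]) (use order_trans[OF Ple[OF r(1)] r(2)] in simp)
  qed (auto simp: P.emeasure_eq_measure)
  ultimately have "AE \<eta> in P. False"
  proof eventually_elim
    case (elim \<eta>)
    then have "eventually (\<lambda>k. False) sequentially"
      by (rule eventually_elim2) auto
    then show False by simp
  qed
  then show False by simp
qed

section \<open>Separating constants when the integral diverges\<close>

lemma poisson_hellinger_finite:
  fixes f :: "'a \<Rightarrow> real"
  assumes mu: "sets mu = sets S" "sigma_finite_measure mu" and lam_sf: "sigma_finite_measure lam"
    and f [measurable]: "f \<in> borel_measurable mu" and nn: "\<And>x. 0 \<le> f x"
    and lam: "lam = density mu (\<lambda>x. ennreal (f x))"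
    and P: "poisson_pp_distribution S lam P" and Q: "poisson_pp_distribution S mu Q"
    and ac: "absolutely_continuous Q P"
  shows "(\<integral>\<^sup>+ x. ennreal ((sqrt (f x) - 1)\<^sup>2) \<partial>mu) < \<infinity>"
proof (rule ccontr)
  assume "\<not> ?thesis"
  then have inf: "(\<integral>\<^sup>+ x. ennreal ((sqrt (f x) - 1)\<^sup>2) \<partial>mu) = \<infinity>" by (simp add: not_less top_unique)
  have sl: "sets lam = sets mu" by (simp add: lam)
  interpret pm: sigma_finite_measure "plus_measure lam mu"
    using sigma_finite_plus_measure[OF lam_sf mu(2) sl] .
  \<comment> \<open>Exhausting by sets of finite sum measure makes both intensities finite on each
    piece.\<close>
  obtain F :: "nat \<Rightarrow> 'a set" where F: "range F \<subseteq> sets (plus_measure lam mu)"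
    "(\<Union>i. F i) = space (plus_measure lam mu)" "\<And>i. emeasure (plus_measure lam mu) (F i) \<noteq> \<infinity>"
    using pm.sigma_finite by metis
  have Fm [measurable]: "F i \<in> sets mu" for i using F(1) sl by auto
  have Ffin: "emeasure lam (F i) < \<infinity>" "emeasure mu (F i) < \<infinity>" for i
    using F(3)[of i] Fm[of i] sl by (auto simp: emeasure_plus_measure less_top)
  have Fun: "(\<Union>i. F i) = space mu" using F(2) sets_eq_imp_space_eq[OF sl] by simp
  \<comment> \<open>An index \<open>n\<close> encodes a pair: a rational candidate for the
    separating constant and the number of a piece \<open>F j\<close>.\<close>
  define q :: "nat \<Rightarrow> real" where "q n = of_rat (nat_to_rat_surj (fst (prod_decode n)))" for n
  define L where "L n = {x\<in>space mu. x \<in> F (snd (prod_decode n)) \<and> (sqrt (f x) - 1)\<^sup>2 \<le> 4 * (q n - 1)\<^sup>2 \<and>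
    (1 < q n \<and> q n \<le> sqrt (f x) \<or> 0 < q n \<and> q n < 1 \<and> sqrt (f x) \<le> q n)}" for n
  have [measurable]: "L n \<in> sets mu" for n unfolding L_def by measurable
  \<comment> \<open>The shift by one fits products over \<open>{1..n}\<close>. Disjointing keeps
    each cell inside its \<open>L\<close>, hence keeps its constant.\<close>
  define C where "C i = disjointed L (i - 1)" for i
  \<comment> \<open>For nonpositive \<open>q\<close> the set \<open>L\<close> is empty; the default
    \<open>1\<close> keeps every \<open>c i\<close> positive.\<close>
  define c where "c i = (if 0 < q (i - 1) then q (i - 1) else 1)" for i
  have "range (disjointed L) \<subseteq> sets mu" by (intro sets.range_disjointed_sets) auto
  then have Cm [measurable]: "C i \<in> sets mu" for i by (auto simp: C_def)
  have CL: "C i \<subseteq> L (i - 1)" for i unfolding C_def by (rule disjointed_subset)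
  have CF: "emeasure lam (C i) < \<infinity>" "emeasure mu (C i) < \<infinity>" for i
  proof -
    have s: "C i \<subseteq> F (snd (prod_decode (i - 1)))" using CL[of i] by (auto simp: L_def)
    show "emeasure lam (C i) < \<infinity>" "emeasure mu (C i) < \<infinity>"
      using Ffin[of "snd (prod_decode (i - 1))"] emeasure_mono[OF s, of lam] emeasure_mono[OF s, of mu] Fm sl
      by (auto intro: le_less_trans)
  qed
  define l where "l i = measure lam (C i)" for i
  define m where "m i = measure mu (C i)" for i
  have l: "emeasure lam (C i) = ennreal (l i)" "0 \<le> l i" and m: "emeasure mu (C i) = ennreal (m i)" "0 \<le> m i" for i
    using CF[of i] by (auto simp: l_def m_def emeasure_eq_ennreal_measure less_top)
  define a where "a i = m i * (c i - 1)\<^sup>2" for i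
  have lamC: "emeasure lam (C i) = (\<integral>\<^sup>+ x. ennreal (f x) * indicator (C i) x \<partial>mu)" for i
    unfolding lam by (rule emeasure_density) auto
  have le: "m i * (c i - 1) + l i * (1 / c i - 1) \<le> - a i" for i
  proof -
    consider "C i = {}" | "1 < q (i - 1)" "C i \<noteq> {}" | "0 < q (i - 1)" "q (i - 1) < 1" "C i \<noteq> {}"
      using CL[of i] by (fastforce simp: L_def)
    then show ?thesis
    proof cases
      case 1
      then show ?thesis by (simp add: a_def l_def m_def)
    next
      case 2
      then have c: "c i = q (i - 1)" "1 < c i" by (auto simp: c_def)
      \<comment> \<open>This gives \<open>l i \<ge> (c i)\<^sup>2 * m i\<close>, and
        \<open>1 / c i - 1\<close> is negative. In the remaining case both signs reverse. Either way
        the bound is \<open>m i * (c i - 1) + m i * c i * (1 - c i) = - a i\<close>.\<close>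
      have "(c i)\<^sup>2 \<le> f x" if "x \<in> C i" for x
        using that CL[of i] c nn[of x] by (auto simp: L_def intro!: sqrt_ge_absD)
      then have "(\<integral>\<^sup>+ x. ennreal ((c i)\<^sup>2) * indicator (C i) x \<partial>mu) \<le> emeasure lam (C i)"
        unfolding lamC by (intro nn_integral_mono) (auto simp: indicator_def ennreal_leI)
      then have "(c i)\<^sup>2 * m i \<le> l i"
        using l m by (simp add: nn_integral_cmult ennreal_mult[symmetric])
      then have "l i * (1 / c i - 1) \<le> (c i)\<^sup>2 * m i * (1 / c i - 1)"
        using c by (intro mult_right_mono_neg) auto
      also have "\<dots> = m i * c i * (1 - c i)" using c by (simp add: field_simps power2_eq_square)
      finally show ?thesis by (simp add: a_def algebra_simps power2_eq_square)
    next
      case 3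
      then have c: "c i = q (i - 1)" "0 < c i" "c i < 1" by (auto simp: c_def)
      have "f x \<le> (c i)\<^sup>2" if "x \<in> C i" for x
        using that CL[of i] c nn[of x] by (auto simp: L_def intro!: sqrt_le_D)
      then have "emeasure lam (C i) \<le> (\<integral>\<^sup>+ x. ennreal ((c i)\<^sup>2) * indicator (C i) x \<partial>mu)"
        unfolding lamC by (intro nn_integral_mono) (auto simp: indicator_def ennreal_leI)
      then have "l i \<le> (c i)\<^sup>2 * m i"
        using l m by (simp add: nn_integral_cmult ennreal_mult[symmetric])
      then have "l i * (1 / c i - 1) \<le> (c i)\<^sup>2 * m i * (1 / c i - 1)"
        using c by (intro mult_right_mono) auto
      also have "\<dots> = m i * c i * (1 - c i)" using c by (simp add: field_simps power2_eq_square)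
      finally show ?thesis by (simp add: a_def algebra_simps power2_eq_square)
    qed
  qed
  have cover: "sqrt (f x) = 1" if x: "x \<in> space mu" "x \<notin> (\<Union>n. L n)" for x
  proof (rule ccontr)
    assume ne: "sqrt (f x) \<noteq> 1"
    define u where "u = sqrt (f x)"
    have u: "u \<noteq> 1" "0 \<le> u" using ne nn[of x] by (auto simp: u_def)
    have "\<exists>t::rat. (u - 1)\<^sup>2 \<le> 4 * (of_rat t - 1)\<^sup>2 \<and>
      (1 < (of_rat t :: real) \<and> of_rat t \<le> u \<or> 0 < (of_rat t :: real) \<and> of_rat t < (1 :: real) \<and> u \<le> of_rat t)"
    proof (cases "1 < u")
      case True
      \<comment> \<open>A rational between \<open>u\<close> and the midpoint of \<open>u\<close> and
        \<open>1\<close> separates the two and is at least half as far from \<open>1\<close> as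
        \<open>u\<close> is.\<close>
      then obtain t where t: "(1 + u) / 2 < of_rat t" "of_rat t < u"
        using of_rat_dense[of "(1 + u) / 2" u] by auto
      define r :: real where "r = of_rat t"
      note t = t[folded r_def]
      have "(u - 1)\<^sup>2 \<le> (2 * (r - 1))\<^sup>2" using t True by (intro power_mono) auto
      then have "(u - 1)\<^sup>2 \<le> 4 * (r - 1)\<^sup>2" unfolding power_mult_distrib by simp
      moreover have "1 < r" using less_trans[OF _ t(1), of 1] True by simp
      moreover have "r \<le> u" using t by simp
      ultimately show ?thesis unfolding r_def by blast
    next
      case False
      then have "u < 1" using u by simp
      then obtain t where t: "u < of_rat t" "of_rat t < (1 + u) / 2"
        using of_rat_dense[of u "(1 + u) / 2"] by auto
      define r :: real where "r = of_rat t"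
      note t = t[folded r_def]
      have "(1 - u)\<^sup>2 \<le> (2 * (1 - r))\<^sup>2" using t \<open>u < 1\<close> by (intro power_mono) auto
      then have "(u - 1)\<^sup>2 \<le> 4 * (r - 1)\<^sup>2"
        unfolding power_mult_distrib by (simp add: power2_commute)
      moreover have "r < 1" using less_trans[OF t(2), of 1] \<open>u < 1\<close> by simp
      moreover have "0 < r" "u \<le> r" using t u by auto
      ultimately show ?thesis unfolding r_def by blast
    qed
    then obtain t :: rat where t: "(u - 1)\<^sup>2 \<le> 4 * (of_rat t - 1)\<^sup>2"
      "1 < (of_rat t :: real) \<and> of_rat t \<le> u \<or> 0 < (of_rat t :: real) \<and> of_rat t < (1 :: real) \<and> u \<le> of_rat t" by blast
    obtain n where n: "t = nat_to_rat_surj n" using surj_nat_to_rat_surj by blast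
    obtain j where j: "x \<in> F j" using x Fun by blast
    have "x \<in> L (prod_encode (n, j))"
      using x t j by (simp add: L_def q_def n u_def)
    then show False using x by blast
  qed
  \<comment> \<open>At each point the term of its own cell already dominates, the factor
    \<open>4\<close> being the square of the \<open>2\<close> lost in the choice of constants. So
    divergence of the integral forces divergence of the sum of the \<open>a i\<close>.\<close>
  have "(\<integral>\<^sup>+ x. ennreal ((sqrt (f x) - 1)\<^sup>2) \<partial>mu) \<le>
      (\<integral>\<^sup>+ x. (\<Sum>i. ennreal (4 * (c (Suc i) - 1)\<^sup>2) * indicator (C (Suc i)) x) \<partial>mu)"
  proof (rule nn_integral_mono)
    fix x assume x: "x \<in> space mu"
    show "ennreal ((sqrt (f x) - 1)\<^sup>2) \<le> (\<Sum>i. ennreal (4 * (c (Suc i) - 1)\<^sup>2) * indicator (C (Suc i)) x)"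
    proof (cases "x \<in> (\<Union>n. L n)")
      case True
      then have "x \<in> (\<Union>n. disjointed L n)" by (simp add: UN_disjointed_eq)
      then obtain i where i: "x \<in> C (Suc i)" by (auto simp: C_def)
      then have "x \<in> L i" using CL[of "Suc i"] by auto
      define g where "g j = ennreal (4 * (c (Suc j) - 1)\<^sup>2) * indicator (C (Suc j)) x" for j
      have "ennreal ((sqrt (f x) - 1)\<^sup>2) \<le> g i"
        using i \<open>x \<in> L i\<close> by (auto simp: g_def L_def c_def intro!: ennreal_leI)
      also have "\<dots> = sum g {i}" by simp
      also have "\<dots> \<le> suminf g" by (intro sum_le_suminf) auto
      finally show ?thesis unfolding g_def .
    qed (use cover x in simp)
  qed
  also have "\<dots> = (\<Sum>i. ennreal (4 * (c (Suc i) - 1)\<^sup>2) * emeasure mu (C (Suc i)))"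
    by (subst nn_integral_suminf) (auto simp: nn_integral_cmult)
  also have "\<dots> = (\<Sum>i. ennreal (4 * a (Suc i)))"
    using m by (simp add: a_def ennreal_mult[symmetric] mult_ac)
  finally have inf_a: "(\<Sum>i. ennreal (4 * a (Suc i))) = \<infinity>" using inf by (simp add: top_unique)
  have a0: "0 \<le> a i" for i using m by (simp add: a_def)
  have unb: "\<exists>n\<ge>1. b \<le> (\<Sum>i\<in>{1..n}. a i)" for b
  proof (rule ccontr)
    assume *: "\<not> ?thesis"
    \<comment> \<open>The maximum with \<open>0\<close> covers the empty sum, about which the
      assumption says nothing.\<close>
    have b: "(\<Sum>i<n. a (Suc i)) \<le> max 0 b" for n
    proof (cases n)
      case (Suc k)
      then have "1 \<le> n" by simp
      then have "\<not> b \<le> (\<Sum>i\<in>{1..n}. a i)" using * by blast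
      then show ?thesis by (simp add: sum.atLeast1_atMost_eq)
    qed simp
    have "(\<Sum>i. ennreal (4 * a (Suc i))) \<le> ennreal (4 * max 0 b)"
    proof (rule suminf_le_const)
      fix n
      have "(\<Sum>i<n. ennreal (4 * a (Suc i))) = ennreal (4 * (\<Sum>i<n. a (Suc i)))"
        using a0 by (simp add: sum_distrib_left)
      also have "\<dots> \<le> ennreal (4 * max 0 b)" using b by (intro ennreal_leI) simp
      finally show "(\<Sum>i<n. ennreal (4 * a (Suc i))) \<le> ennreal (4 * max 0 b)" .
    qed simp
    then show False using inf_a by (simp add: top_unique)
  qed
  have dis: "disjoint_family_on C {1..n}" for n
  proof (unfold disjoint_family_on_def, intro ballI impI)
    fix i j assume "i \<in> {1..n}" "j \<in> {1..n}" "i \<noteq> j"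
    \<comment> \<open>Both indices are at least \<open>1\<close>, so truncated subtraction keeps
      them apart; \<open>C 0\<close> and \<open>C 1\<close> coincide.\<close>
    then have "i - 1 \<noteq> j - 1" by auto
    then show "C i \<inter> C j = {}"
      using disjoint_family_disjointed[of L] by (auto simp: C_def disjoint_family_on_def)
  qed
  have "\<not> absolutely_continuous Q P"
    using poisson_not_absolutely_continuous[OF P Q _ dis l m _ le unb] Cm mu(1) by (auto simp: c_def)
  then show False using ac by contradiction
qed

section \<open>The equivalence\<close>

theorem theorem5p5:
  fixes S lam mu :: "'a measure"
    and P_lam P_mu :: "'a measure measure"
  assumes "sets lam = sets S" and "sigma_finite_measure lam"
    and "sets mu = sets S" and "sigma_finite_measure mu"
    and "poisson_pp_distribution S lam P_lam"
    and "poisson_pp_distribution S mu P_mu"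
  shows "absolutely_continuous P_mu P_lam \<longleftrightarrow>
    absolutely_continuous mu lam \<and> hellinger_dist lam mu < \<infinity>"
proof -
  have sl: "sets lam = sets mu" using assms by simp
  have hell: "hellinger_dist lam mu < \<infinity> \<longleftrightarrow> (\<integral>\<^sup>+ x. ennreal ((sqrt (f x) - 1)\<^sup>2) \<partial>mu) < \<infinity>"
    if "f \<in> borel_measurable mu" "\<And>x. 0 \<le> f x" "density mu (\<lambda>x. ennreal (f x)) = lam" for f
  proof -
    \<comment> \<open>With \<open>mu\<close> itself as reference measure the densities are
      \<open>f\<close> and \<open>1\<close>; the square root and the factor \<open>1 / 2\<close>
      preserve finiteness.\<close>
    have "densities_wrt mu lam mu f (\<lambda>_. 1)"
      using that assms(4) by (simp add: densities_wrt_def density_1)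
    then have "hellinger_dist lam mu = hellinger_formula mu f (\<lambda>_. 1)" by (rule hellinger_dist_eq)
    then have h: "hellinger_dist lam mu = ennsqrt (1 / 2 * (\<integral>\<^sup>+ x. ennreal ((sqrt (f x) - 1)\<^sup>2) \<partial>mu))"
      by (simp add: hellinger_formula_def)
    have sqrt: "ennsqrt y < \<infinity> \<longleftrightarrow> y < \<infinity>" for y
      by (simp add: ennsqrt_def less_top)
    have half: "(1 / 2 :: ennreal) < \<top>" by (simp add: divide_ennreal_def less_top[symmetric])
    have "1 / 2 * y < \<infinity> \<longleftrightarrow> y < \<infinity>" for y :: ennreal
      using half by (cases "y = 0") (simp_all add: ennreal_mult_less_top)
    then show ?thesis unfolding h sqrt .
  qed
  show ?thesis
  proof
    assume ac: "absolutely_continuous P_mu P_lam"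
    have "absolutely_continuous mu lam"
      unfolding absolutely_continuous_def
    proof
      fix A assume A: "A \<in> null_sets mu"
      have AS: "A \<in> sets S" by (rule null_setsD2[OF A, unfolded assms(3)])
      \<comment> \<open>The event that \<open>A\<close> contains a point has probability zero
        exactly when the intensity of \<open>A\<close> is zero.\<close>
      let ?E = "{\<eta>\<in>point_patterns S. emeasure \<eta> A \<noteq> 0}"
      note v = poisson_pp_distribution_void[OF assms(5) AS] poisson_pp_distribution_void[OF assms(6) AS]
      have "emeasure mu A = 0" using A by auto
      then have "?E \<in> null_sets P_mu"
        using v by (intro null_setsI) (simp_all add: emeasure_poisson_measure_nonzero_eq_0_iff)
      then have "emeasure P_lam ?E = 0" using ac unfolding absolutely_continuous_def by auto
      then show "A \<in> null_sets lam"
        using v AS assms(1) by (intro null_setsI) (simp_all add: emeasure_poisson_measure_nonzero_eq_0_iff)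
    qed
    moreover from obtain_real_density[OF assms(4,2) sl this] obtain f where
      f: "f \<in> borel_measurable mu" "\<And>x. 0 \<le> f x" "density mu (\<lambda>x. ennreal (f x)) = lam" by blast
    have "(\<integral>\<^sup>+ x. ennreal ((sqrt (f x) - 1)\<^sup>2) \<partial>mu) < \<infinity>"
      by (rule poisson_hellinger_finite[OF assms(3,4,2) f(1,2) f(3)[symmetric] assms(5,6) ac])
    ultimately show "absolutely_continuous mu lam \<and> hellinger_dist lam mu < \<infinity>"
      using hell[OF f] by simp
  next
    assume *: "absolutely_continuous mu lam \<and> hellinger_dist lam mu < \<infinity>"
    obtain f where f: "f \<in> borel_measurable mu" "\<And>x. 0 \<le> f x" "density mu (\<lambda>x. ennreal (f x)) = lam"
      using obtain_real_density[OF assms(4,2) sl] * by blast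
    show "absolutely_continuous P_mu P_lam"
      using * hell[OF f] by (intro poisson_absolutely_continuous[OF assms(3) f(1,2) f(3)[symmetric] assms(5,6)]) simp
  qed
qed

end
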